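(* Let $\mu_1,\mu_2$ be nonzero large Fourier quasicrystals on $\mathbb{R}^d$ with supports $\Lambda_1,\Lambda_2$ such that the set of differences $\Lambda_1-\Lambda_2=\{\lambda_1-\lambda_2:\ \lambda_1\in\Lambda_1,\ \lambda_2\in\Lambda_2\}$ is discrete. Then there exists a full-rank lattice $L\subset\mathbb{R}^d$ such that both $\Lambda_1$ and $\Lambda_2$ are finite unions of translates of $L$.
   Context: Notation: $B(x,r)=\{y\in\mathbb{R}^d:|y-x|<r\}$, $B(r)=B(0,r)$; $\delta_z$ is the unit mass at $z$. A set $E\subset\mathbb{R}^d$ is discrete if $E\cap B(x,1)$ is finite for every $x\in\mathbb{R}^d$. A full-rank lattice is a set $T\mathbb{Z}^d$ with $T$ a nondegenerate linear operator on $\mathbb{R}^d$. Measures are complex Radon measures. A measure $\mu$ is slowly increasing if its variation satisfies: $|\mu|(B(r))$ grows at most polynomially as $r\to\infty$; such a measure is a tempered distribution. The Fourier transform of $f\in S'(\mathbb{R}^d)$ is defined by $\hat f(\varphi)=f(\hat\varphi)$ for $\varphi\in S(\mathbb{R}^d)$, where $\hat\varphi(y)=\int_{\mathbb{R}^d}\varphi(x)e^{-2\pi i\langle x,y\rangle}dx$. A measure $\mu$ is a Fourier quasicrystal if both $\mu$ and $\hat\mu$ are slowly increasing atomic measures, i.e. $\mu=\sum_{\lambda\in\Lambda}a_\lambda\delta_\lambda$, $\hat\mu=\sum_{\gamma\in\Gamma}b_\gamma\delta_\gamma$ with countable sets $\Lambda,\Gamma$, nonzero coefficients, and $\sum_{|\lambda|<r}|a_\lambda|+\sum_{|\gamma|<r}|b_\gamma|$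 growing at most polynomially as $r\to\infty$. $\Lambda$ is called the support of $\mu$. The quasicrystal is large if in addition $\inf_{\lambda\in\Lambda}|a_\lambda|>0$. *)

theory Defs
  imports "HOL-Analysis.Analysis" "HOL-Library.Landau_Symbols"
begin

section \<open>Schwartz functions and tempered distributions\<close>

text \<open>
  \<open>\<real>\<^sup>d\<close> is an arbitrary type of class \<open>euclidean_space\<close> (so \<open>d = DIM('a) \<ge> 1\<close>), with the
  coordinate directions given by \<open>Basis\<close>. The list \<open>vs\<close> plays the role of a multi-index.
\<close>

primrec iterated_deriv ::
  "'a::euclidean_space list \<Rightarrow> ('a \<Rightarrow> complex) \<Rightarrow> ('a \<Rightarrow> complex)" where
  "iterated_deriv [] f = f"
| "iterated_deriv (v # vs) f = (\<lambda>x. frechet_derivative (iterated_deriv vs f) (at x) v)"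

text \<open>
  A function all of whose iterated partial derivatives are (Frechet) differentiable everywhere
  is the same as a smooth function.
\<close>

definition schwartz :: "('a::euclidean_space \<Rightarrow> complex) set" where
  "schwartz = {f. \<forall>vs. set vs \<subseteq> Basis \<longrightarrow>
      (\<forall>x. iterated_deriv vs f differentiable (at x)) \<and>
      (\<forall>k::nat. bounded (range (\<lambda>x. norm x ^ k *\<^sub>R iterated_deriv vs f x)))}"

definition schwartz_seminorm ::
  "nat \<Rightarrow> 'a::euclidean_space list \<Rightarrow> ('a \<Rightarrow> complex) \<Rightarrow> real" where
  "schwartz_seminorm k vs f = (SUP x. norm x ^ k * norm (iterated_deriv vs f x))"

text \<open>
  Distributions are functionals on the type of all functions; only their values on
  \<^const>\<open>schwartz\<close> are meaningful.
\<close>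

type_synonym 'a distribution = "('a \<Rightarrow> complex) \<Rightarrow> complex"

definition tempered_distribution :: "'a::euclidean_space distribution \<Rightarrow> bool" where
  "tempered_distribution T \<longleftrightarrow>
     (\<forall>f\<in>schwartz. \<forall>g\<in>schwartz. T (\<lambda>x. f x + g x) = T f + T g) \<and>
     (\<forall>c. \<forall>f\<in>schwartz. T (\<lambda>x. c * f x) = c * T f) \<and>
     (\<exists>C N. \<forall>f\<in>schwartz.
        norm (T f) \<le> C * (\<Sum>k\<le>N. \<Sum>vs\<in>{vs. set vs \<subseteq> Basis \<and> length vs \<le> N}.
                                 schwartz_seminorm k vs f))"

definition fourier :: "('a::euclidean_space \<Rightarrow> complex) \<Rightarrow> ('a \<Rightarrow> complex)" where
  "fourier f y = (LINT x|lborel. f x * exp (- 2 * of_real pi * \<i> * of_real (x \<bullet> y)))"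

definition fourier_distribution :: "'a::euclidean_space distribution \<Rightarrow> 'a distribution" where
  "fourier_distribution T f = T (fourier f)"

definition dirac :: "'a::euclidean_space \<Rightarrow> 'a distribution" where
  "dirac z f = f z"


section \<open>Fourier quasicrystals\<close>

text \<open>
  \<open>slowly_increasing_atomic T \<Lambda> a\<close>: the tempered distribution \<open>T\<close> is (given by) the measure
  \<open>\<mu> = \<Sum>z\<in>\<Lambda>. a z \<delta>\<^sub>z\<close> with countable support \<open>\<Lambda>\<close> and masses \<open>a z \<noteq> 0\<close>. The sum of the
  \<open>norm (a z)\<close> over \<open>\<Lambda> \<inter> ball 0 r\<close> is the variation \<open>|\<mu>|(B(r))\<close>; its finiteness makes \<open>\<mu>\<close> a
  complex Radon measure, and its polynomial growth makes the series defining \<open>T f\<close> absolutely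
  convergent for every Schwartz function \<open>f\<close>. Slowly increasing measures are identified with
  the tempered distributions they define.
\<close>

definition slowly_increasing_atomic ::
  "'a::euclidean_space distribution \<Rightarrow> 'a set \<Rightarrow> ('a \<Rightarrow> complex) \<Rightarrow> bool" where
  "slowly_increasing_atomic T \<Lambda> a \<longleftrightarrow>
     tempered_distribution T \<and>
     countable \<Lambda> \<and>
     (\<forall>z\<in>\<Lambda>. a z \<noteq> 0) \<and>
     (\<forall>r. (\<lambda>z. norm (a z)) summable_on (\<Lambda> \<inter> ball 0 r)) \<and>
     (\<exists>N::nat. (\<lambda>r::real. \<Sum>\<^sub>\<infinity>z\<in>\<Lambda> \<inter> ball 0 r. norm (a z)) \<in> O[at_top](\<lambda>r. r ^ N)) \<and>
     (\<forall>f\<in>schwartz. ((\<lambda>z. a z * dirac z f) has_sum T f) \<Lambda>)"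

definition fourier_quasicrystal ::
  "'a::euclidean_space distribution \<Rightarrow> 'a set \<Rightarrow> ('a \<Rightarrow> complex) \<Rightarrow> bool" where
  "fourier_quasicrystal \<mu> \<Lambda> a \<longleftrightarrow>
     slowly_increasing_atomic \<mu> \<Lambda> a \<and>
     (\<exists>\<Gamma> b. slowly_increasing_atomic (fourier_distribution \<mu>) \<Gamma> b)"

text \<open>The infimum is taken in \<^typ>\<open>ereal\<close> so that it is meaningful also for empty \<open>\<Lambda>\<close>.\<close>

definition large_fourier_quasicrystal ::
  "'a::euclidean_space distribution \<Rightarrow> 'a set \<Rightarrow> bool" where
  "large_fourier_quasicrystal \<mu> \<Lambda> \<longleftrightarrow>
     (\<exists>a. fourier_quasicrystal \<mu> \<Lambda> a \<and> 0 < (INF z\<in>\<Lambda>. ereal (norm (a z))))"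

definition nonzero_distribution :: "'a::euclidean_space distribution \<Rightarrow> bool" where
  "nonzero_distribution T \<longleftrightarrow> (\<exists>f\<in>schwartz. T f \<noteq> 0)"


section \<open>Discrete sets and lattices\<close>

text \<open>
  Stronger than the topological notion of a set all of whose points are isolated: the set may
  not have accumulation points anywhere in the space.
\<close>

definition discrete_in_space :: "'a::euclidean_space set \<Rightarrow> bool" where
  "discrete_in_space E \<longleftrightarrow> (\<forall>x. finite (E \<inter> ball x 1))"

definition integer_points :: "'a::euclidean_space set" where
  "integer_points = {x. \<forall>b\<in>Basis. x \<bullet> b \<in> \<int>}"

definition full_rank_lattice :: "'a::euclidean_space set \<Rightarrow> bool" where
  "full_rank_lattice L \<longleftrightarrow> (\<exists>T::'a \<Rightarrow> 'a. linear T \<and> bij T \<and> L = T ` integer_points)"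

definition finite_union_of_translates :: "'a::euclidean_space set \<Rightarrow> 'a set \<Rightarrow> bool" where
  "finite_union_of_translates E L \<longleftrightarrow> (\<exists>F. finite F \<and> E = (\<Union>t\<in>F. (+) t ` L))"

end

theory Submission
  imports Defs "HOL-Probability.Characteristic_Functions"
begin

text \<open>
  Each \<open>\<Lambda>\<^sub>i\<close> is shown to be an almost periodic point set, and an almost periodic set with
  locally finite differences is exactly periodic.

  Almost periodicity. Fix a bump \<open>\<phi>\<close> with small support and \<open>\<phi> 0 = 1\<close>. For a Fourier quasicrystal
  with masses \<open>a\<close> and frequency masses \<open>b\<close>, Poisson summation turns \<open>H x = \<Sum>z\<in>\<Lambda>. a z \<phi>(z - x)\<close> into
  \<open>\<Sum>\<gamma>\<in>\<Gamma>. b \<gamma> \<Phi>(\<gamma>) exp(2 \<pi> i \<gamma> \<bullet> x)\<close>, where \<open>\<Phi>\<close> is the Fourier transform of \<open>\<phi>\<close>. If \<open>\<Phi>\<close> decays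
  faster than the masses of \<open>b\<close> grow, this series converges absolutely, so \<open>H\<close> is Bochner almost
  periodic. Since \<open>\<phi>\<close> is concentrated near \<open>0\<close>, \<open>H x \<noteq> 0\<close> forces a point of \<open>\<Lambda>\<close> near \<open>x\<close>, and
  \<open>H u = a u\<close> at an isolated point \<open>u\<close>, where \<open>norm (a u)\<close> is bounded below because the quasicrystal is
  large. Hence a sufficiently good almost period \<open>\<tau>\<close> moves each point of \<open>\<Lambda>\<close> to within \<open>\<delta>\<close> of a
  point of \<open>\<Lambda>\<close>. This is \<open>large_fourier_quasicrystal_detected\<close>.

  Poisson summation by Gaussians. The pairing with test functions yields the summation formula
  directly for Gaussians times characters, whose Fourier transforms are heat kernels. Integrating
  that formula against \<open>\<phi>\<close> and letting the width of the heat kernel tend to \<open>0\<close> gives it for \<open>\<phi>\<close>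
  (\<open>cube_bump_Poisson_summation\<close>). Only finitely many derivatives of \<open>\<phi>\<close> matter for this, so
  \<open>\<phi>\<close> may be a product of powers of truncated cosines, for which the decay of \<open>\<Phi>\<close> follows from a
  two-step recurrence.

  Exact periodicity. Discreteness of \<open>\<Lambda>\<^sub>1\<close> and of \<open>\<Lambda>\<^sub>2\<close> follows from that of \<open>\<Lambda>\<^sub>1 - \<Lambda>\<^sub>2\<close>; a nonempty
  almost periodic discrete set is relatively dense; and comparing two points with a third one nearby shows
  that \<open>U = \<Lambda>\<^sub>1 \<union> \<Lambda>\<^sub>2\<close> has a discrete difference set. Now let an almost period \<open>\<tau>\<close> move \<open>u\<close> to \<open>u'\<close>
  and a neighbour \<open>v\<close> to \<open>v'\<close>. The differences \<open>u - v\<close> and \<open>u' - v'\<close> are almost equal and lie in one finite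
  set, so they are equal. Thus the displacement \<open>u' - u\<close> agrees at neighbouring points, hence is a
  constant \<open>\<sigma>\<close>, and \<open>\<sigma>\<close> is a common period of \<open>\<Lambda>\<^sub>1\<close> and \<open>\<Lambda>\<^sub>2\<close> close to \<open>\<tau>\<close>
  (\<open>rigid_displacement\<close>, \<open>common_exact_periods\<close>). The group of common periods is therefore
  relatively dense, so it contains a basis of the space; the lattice spanned by that basis works,
  because a fundamental cell meets each of the discrete sets \<open>\<Lambda>\<^sub>i\<close> in finitely many points.
\<close>

section \<open>Gaussians are Schwartz functions\<close>

text \<open>
  The complex-valued polynomial functions, generated as an algebra. Only closure under derivatives
  and under products with affine functions, and polynomial growth, matter below, and the inductive
  form gives these directly.
\<close>

inductive_set polynomial_functions :: "('a::euclidean_space \<Rightarrow> complex) set" where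
  const: "(\<lambda>x. c) \<in> polynomial_functions"
| linear: "(\<lambda>x. of_real (x \<bullet> v)) \<in> polynomial_functions"
| add: "p \<in> polynomial_functions \<Longrightarrow> q \<in> polynomial_functions \<Longrightarrow> (\<lambda>x. p x + q x) \<in> polynomial_functions"
| mult: "p \<in> polynomial_functions \<Longrightarrow> q \<in> polynomial_functions \<Longrightarrow> (\<lambda>x. p x * q x) \<in> polynomial_functions"

text \<open>
  One witness \<open>D\<close> serves both as total derivative (in its first argument) and as family of
  directional derivatives, so that the latter are seen to be polynomial functions again.
\<close>

lemma polynomial_functions_derivative:
  assumes "p \<in> polynomial_functions"
  shows "\<exists>D. (\<forall>x. (p has_derivative (\<lambda>h. D h x)) (at x)) \<and> (\<forall>v. D v \<in> polynomial_functions)"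
  using assms
proof induction
  case (const c)
  show ?case
    by (rule exI[of _ "\<lambda>h x. 0"]) (auto intro: polynomial_functions.intros)
next
  case (linear v)
  have "((\<lambda>x. complex_of_real (x \<bullet> v)) has_derivative (\<lambda>h. of_real (h \<bullet> v))) (at x)" for x
    by (auto intro!: derivative_eq_intros)
  then show ?case
    by (intro exI[of _ "\<lambda>h x. of_real (h \<bullet> v)"]) (auto intro: polynomial_functions.intros)
next
  case (add p q)
  then obtain D E where
    "\<And>x. (p has_derivative (\<lambda>h. D h x)) (at x)" "\<And>v. D v \<in> polynomial_functions"
    "\<And>x. (q has_derivative (\<lambda>h. E h x)) (at x)" "\<And>v. E v \<in> polynomial_functions" by blast
  then show ?case
    by (intro exI[of _ "\<lambda>h x. D h x + E h x"])
       (auto intro!: polynomial_functions.intros has_derivative_add)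
next
  case (mult p q)
  then obtain D E where
    "\<And>x. (p has_derivative (\<lambda>h. D h x)) (at x)" "\<And>v. D v \<in> polynomial_functions"
    "\<And>x. (q has_derivative (\<lambda>h. E h x)) (at x)" "\<And>v. E v \<in> polynomial_functions" by blast
  with mult.hyps show ?case
    by (intro exI[of _ "\<lambda>h x. p x * E h x + D h x * q x"])
       (auto intro!: polynomial_functions.add polynomial_functions.mult has_derivative_mult)
qed

lemma polynomial_functions_growth:
  fixes p :: "'a::euclidean_space \<Rightarrow> complex"
  assumes "p \<in> polynomial_functions"
  shows "\<exists>C\<ge>0. \<exists>N. \<forall>x. norm (p x) \<le> C * (1 + norm x) ^ N"
  using assms
proof induction
  case (const c)
  show ?case by (intro exI[of _ "norm c"] conjI exI[of _ 0]) auto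
next
  case (linear v)
  have "norm (complex_of_real (x \<bullet> v)) \<le> norm v * (1 + norm x) ^ 1" for x
    using Cauchy_Schwarz_ineq2[of x v] by (simp add: algebra_simps) (smt (verit) norm_ge_zero)
  then show ?case by (meson norm_ge_zero)
next
  case (add p q)
  then obtain C N D M where CN: "C \<ge> 0" "\<And>x. norm (p x) \<le> C * (1 + norm x) ^ N"
    and DM: "D \<ge> 0" "\<And>x. norm (q x) \<le> D * (1 + norm x) ^ M" by metis
  have "norm (p x + q x) \<le> (C + D) * (1 + norm x) ^ (N + M)" for x
  proof -
    have "(1 + norm x) ^ N \<le> (1 + norm x) ^ (N + M)" "(1 + norm x) ^ M \<le> (1 + norm x) ^ (N + M)"
      by (auto intro!: power_increasing)
    with CN DM show ?thesis
      by (smt (verit, best) distrib_right mult_left_mono norm_triangle_ineq)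
  qed
  with CN DM show ?case by (meson add_nonneg_nonneg)
next
  case (mult p q)
  then obtain C N D M where CN: "C \<ge> 0" "\<And>x. norm (p x) \<le> C * (1 + norm x) ^ N"
    and DM: "D \<ge> 0" "\<And>x. norm (q x) \<le> D * (1 + norm x) ^ M" by metis
  have "norm (p x * q x) \<le> (C * D) * (1 + norm x) ^ (N + M)" for x
    using mult_mono[OF CN(2)[of x] DM(2)[of x]] CN DM
    by (simp add: norm_mult power_add algebra_simps)
  with CN DM show ?case by (meson mult_nonneg_nonneg)
qed

text \<open>
  Shifts and characters are both allowed because the Fourier transform exchanges them: up to a
  constant factor, both sides of the Fourier transform formula below are of this form.
\<close>

definition gaussian_wave :: "real \<Rightarrow> 'a \<Rightarrow> 'a \<Rightarrow> 'a::euclidean_space \<Rightarrow> complex" where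
  "gaussian_wave c y w x = exp (of_real (- c * ((x - y) \<bullet> (x - y))) + \<i> * of_real (w \<bullet> x))"

lemma norm_gaussian_wave: "norm (gaussian_wave c y w x) = exp (- c * (norm (x - y))\<^sup>2)"
  by (simp add: gaussian_wave_def power2_norm_eq_inner)

lemma gaussian_wave_derivative:
  "(gaussian_wave c y w has_derivative
     (\<lambda>h. (of_real (-2 * c * ((x - y) \<bullet> h)) + \<i> * of_real (w \<bullet> h)) * gaussian_wave c y w x)) (at x)"
proof -
  have "((\<lambda>x. of_real (- c * ((x - y) \<bullet> (x - y))) + \<i> * of_real (w \<bullet> x) :: complex) has_derivative
          (\<lambda>h. of_real (-2 * c * ((x - y) \<bullet> h)) + \<i> * of_real (w \<bullet> h))) (at x)"
    by (rule derivative_eq_intros refl)+ (auto simp: fun_eq_iff algebra_simps inner_commute)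
  from has_derivative_compose[OF this DERIV_exp[THEN has_field_derivative_imp_has_derivative]]
  show ?thesis unfolding gaussian_wave_def by (simp add: mult.commute)
qed

text \<open>
  The logarithmic derivative of a Gaussian wave is affine in \<open>x\<close>, so each partial derivative only
  replaces the polynomial factor by another one.
\<close>

lemma iterated_deriv_gaussian_wave:
  assumes "p \<in> polynomial_functions"
  shows "\<exists>q\<in>polynomial_functions.
           iterated_deriv vs (\<lambda>x. p x * gaussian_wave c y w x) = (\<lambda>x. q x * gaussian_wave c y w x)"
proof (induction vs)
  case Nil
  with assms show ?case by auto
next
  case (Cons v vs)
  then obtain q where q: "q \<in> polynomial_functions"
    "iterated_deriv vs (\<lambda>x. p x * gaussian_wave c y w x) = (\<lambda>x. q x * gaussian_wave c y w x)" by blast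
  obtain D where D: "\<And>x. (q has_derivative (\<lambda>h. D h x)) (at x)" "\<And>v. D v \<in> polynomial_functions"
    using polynomial_functions_derivative[OF q(1)] by blast
  define r where "r x = q x * (of_real (x \<bullet> ((-2*c) *\<^sub>R v)) + (of_real (2*c * (y \<bullet> v)) + \<i> * of_real (w \<bullet> v))) + D v x" for x
  have "((\<lambda>x. q x * gaussian_wave c y w x) has_derivative
      (\<lambda>h. q x * ((of_real (-2 * c * ((x - y) \<bullet> h)) + \<i> * of_real (w \<bullet> h)) * gaussian_wave c y w x)
         + D h x * gaussian_wave c y w x)) (at x)" for x
    by (rule has_derivative_mult[OF D(1) gaussian_wave_derivative])
  from frechet_derivative_at[OF this]
  have "iterated_deriv (v # vs) (\<lambda>x. p x * gaussian_wave c y w x) = (\<lambda>x. r x * gaussian_wave c y w x)"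
    by (simp add: q(2) flip: frechet_derivative_at)
       (auto simp: fun_eq_iff r_def algebra_simps)
  moreover have "r \<in> polynomial_functions"
    unfolding r_def by (intro polynomial_functions.intros q(1) D(2))
  ultimately show ?case by blast
qed

text \<open>
  From \<open>1 + r \<le> exp r\<close>, the product is at most \<open>exp (M r - c r\<^sup>2)\<close>; completing the square gives the
  bound.
\<close>

lemma polynomial_times_gaussian_bound:
  fixes r :: real
  assumes "c > 0" "r \<ge> 0"
  shows "(1 + r) ^ M * exp (- c * r\<^sup>2) \<le> exp ((real M)\<^sup>2 / (4 * c))"
proof -
  have "(1 + r) ^ M \<le> exp r ^ M" using assms by (intro power_mono) auto
  also have "\<dots> = exp (real M * r)" by (simp add: exp_of_nat_mult)
  finally have "(1 + r) ^ M * exp (- c * r\<^sup>2) \<le> exp (real M * r) * exp (- c * r\<^sup>2)"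
    by (intro mult_right_mono) auto
  also have "\<dots> = exp (real M * r - c * r\<^sup>2)" by (simp flip: exp_add)
  also have "\<dots> \<le> exp ((real M)\<^sup>2 / (4 * c))"
  proof -
    have "0 \<le> (2 * c * r - real M)\<^sup>2" by simp
    then have "4 * c * (real M * r - c * r\<^sup>2) \<le> (real M)\<^sup>2"
      by (simp add: power2_eq_square algebra_simps)
    with assms show ?thesis by (simp add: field_simps power2_eq_square)
  qed
  finally show ?thesis .
qed

lemma polynomial_times_gaussian_wave_schwartz:
  assumes "p \<in> polynomial_functions" "c > 0"
  shows "(\<lambda>x. p x * gaussian_wave c y w x) \<in> schwartz"
proof -
  let ?E = "gaussian_wave c y w" and ?f = "\<lambda>x. p x * gaussian_wave c y w x"
  { fix vs :: "'a list"
    obtain q where q: "q \<in> polynomial_functions" "iterated_deriv vs ?f = (\<lambda>x. q x * ?E x)"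
      using iterated_deriv_gaussian_wave[OF assms(1), of vs c y w] by blast
    obtain D where D: "\<And>x. (q has_derivative (\<lambda>h. D h x)) (at x)"
      using polynomial_functions_derivative[OF q(1)] by blast
    have diff: "iterated_deriv vs ?f differentiable (at x)" for x
      unfolding q(2) differentiable_def using has_derivative_mult[OF D gaussian_wave_derivative] by blast
    obtain C N where CN: "C \<ge> 0" "\<And>x. norm (q x) \<le> C * (1 + norm x) ^ N"
      using polynomial_functions_growth[OF q(1)] by metis
    have "bounded (range (\<lambda>x. norm x ^ k *\<^sub>R iterated_deriv vs ?f x))" for k
    proof -
      let ?B = "C * ((1 + norm y) ^ (k + N) * exp ((real (k+N))\<^sup>2 / (4 * c)))"
      have "norm (norm x ^ k *\<^sub>R iterated_deriv vs ?f x) \<le> ?B" for x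
      proof -
        let ?r = "norm (x - y)"
        have "0 \<le> norm y * ?r" by simp
        then have *: "1 + norm x \<le> (1 + norm y) * (1 + ?r)"
          using norm_triangle_ineq[of "x - y" y]
          unfolding distrib_left distrib_right mult_1 mult_1_right diff_add_cancel by linarith
        have "norm (norm x ^ k *\<^sub>R iterated_deriv vs ?f x) = norm x ^ k * norm (q x) * exp (- c * ?r\<^sup>2)"
          by (simp add: q(2) norm_mult norm_gaussian_wave)
        also have "\<dots> \<le> (1 + norm x) ^ k * (C * (1 + norm x) ^ N) * exp (- c * ?r\<^sup>2)"
          using CN by (intro mult_right_mono mult_mono power_mono) auto
        also have "\<dots> = C * ((1 + norm x) ^ (k + N) * exp (- c * ?r\<^sup>2))"
          by (simp add: power_add algebra_simps)
        also have "\<dots> \<le> C * (((1 + norm y) * (1 + ?r)) ^ (k + N) * exp (- c * ?r\<^sup>2))"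
          using * CN(1) by (intro mult_left_mono mult_right_mono power_mono) auto
        also have "\<dots> = C * ((1 + norm y) ^ (k + N) * ((1 + ?r) ^ (k + N) * exp (- c * ?r\<^sup>2)))"
          by (simp only: power_mult_distrib mult.assoc)
        also have "\<dots> \<le> ?B"
          using polynomial_times_gaussian_bound[OF assms(2), of ?r "k+N"] CN(1)
          by (intro mult_left_mono) auto
        finally show ?thesis .
      qed
      then show ?thesis unfolding bounded_iff by blast
    qed
    note diff this }
  then show ?thesis unfolding schwartz_def by blast
qed

section \<open>The Fourier transform of a Gaussian\<close>

text \<open>
  Lebesgue measure is the product of its coordinate measures, so products of functions of
  one coordinate integrate coordinatewise.
\<close>

lemma integral_lborel_prod_complex:
  fixes f :: "'a::euclidean_space \<Rightarrow> real \<Rightarrow> complex"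
  assumes "\<And>b. b \<in> Basis \<Longrightarrow> integrable lborel (f b)"
  shows "(LINT x|lborel. (\<Prod>b\<in>Basis. f b (x \<bullet> b))) = (\<Prod>b\<in>Basis. LINT u|lborel. f b u)"
proof -
  interpret product_sigma_finite "\<lambda>b::'a. lborel :: real measure" ..
  have [measurable]: "f b \<in> borel_measurable borel" if "b \<in> Basis" for b
    using assms[OF that] by auto
  have "(LINT x|lborel. (\<Prod>b\<in>Basis. f b (x \<bullet> b)))
      = (LINT g|(\<Pi>\<^sub>M b\<in>Basis. lborel). (\<Prod>b\<in>Basis. f b ((\<Sum>b\<in>Basis. g b *\<^sub>R b) \<bullet> b)))"
    by (subst lborel_eq, subst integral_distr) auto
  also have "\<dots> = (LINT g|(\<Pi>\<^sub>M b\<in>Basis. lborel). (\<Prod>b\<in>Basis. f b (g b)))"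
    by simp
  also have "\<dots> = (\<Prod>b\<in>Basis. LINT u|lborel. f b u)"
    by (intro product_integral_prod assms) auto
  finally show ?thesis .
qed

lemma integrable_lborel_prod_complex:
  fixes f :: "'a::euclidean_space \<Rightarrow> real \<Rightarrow> complex"
  assumes "\<And>b. b \<in> Basis \<Longrightarrow> integrable lborel (f b)"
  shows "integrable lborel (\<lambda>x. \<Prod>b\<in>Basis. f b (x \<bullet> b))"
proof -
  interpret product_sigma_finite "\<lambda>b::'a. lborel :: real measure" ..
  have [measurable]: "f b \<in> borel_measurable borel" if "b \<in> Basis" for b
    using assms[OF that] by auto
  have "integrable (\<Pi>\<^sub>M b\<in>Basis. lborel) (\<lambda>g. \<Prod>b\<in>Basis. f b (g b))"
    by (intro product_integrable_prod assms) auto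
  then show ?thesis
    by (subst lborel_eq, subst integrable_distr_eq) auto
qed

text \<open>
  A rescaling of the characteristic function of the standard normal distribution.
\<close>

lemma fourier_gaussian_real:
  fixes s a :: real
  assumes "s > 0"
  shows "integrable lborel (\<lambda>u. exp (of_real (- s\<^sup>2 / 2 * u\<^sup>2) + \<i> * of_real (a * u)))"
    and "(LINT u|lborel. exp (of_real (- s\<^sup>2 / 2 * u\<^sup>2) + \<i> * of_real (a * u)))
           = complex_of_real (sqrt (2 * pi) / s * exp (- a\<^sup>2 / (2 * s\<^sup>2)))"
proof -
  let ?f = "\<lambda>u. of_real (std_normal_density u) * exp (\<i> * of_real (a / s * u)) :: complex"
  have char: "(LINT u|lborel. ?f u) = of_real (exp (- (a / s)\<^sup>2 / 2))"
    using char_std_normal_distribution[THEN fun_cong, of "a / s"]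
    unfolding char_def by (subst (asm) integral_density) (auto simp: scaleR_conv_of_real normal_density_nonneg)
  have intf: "integrable lborel ?f"
    by (rule Bochner_Integration.integrable_bound[OF integrable_normal_moment[of 1 0 0]])
       (auto simp: norm_mult normal_density_nonneg)
  have eq: "exp (of_real (- s\<^sup>2 / 2 * u\<^sup>2) + \<i> * of_real (a * u)) = complex_of_real (sqrt (2 * pi)) * ?f (0 + s * u)" for u
    using assms by (simp add: std_normal_density_def mult_exp_exp power_mult_distrib algebra_simps flip: exp_of_real)
  show "integrable lborel (\<lambda>u. exp (of_real (- s\<^sup>2 / 2 * u\<^sup>2) + \<i> * of_real (a * u)))"
    unfolding eq using intf lborel_integrable_real_affine_iff[of s ?f 0] assms
    by (intro integrable_mult_right) simp
  show "(LINT u|lborel. exp (of_real (- s\<^sup>2 / 2 * u\<^sup>2) + \<i> * of_real (a * u)))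
           = complex_of_real (sqrt (2 * pi) / s * exp (- a\<^sup>2 / (2 * s\<^sup>2)))"
  proof -
    have "of_real (exp (- (a / s)\<^sup>2 / 2)) = of_real s * (LINT u|lborel. ?f (0 + s * u))"
      using lborel_integral_real_affine[of s ?f 0] assms char by (simp only: scaleR_conv_of_real) simp
    then have "(LINT u|lborel. ?f (0 + s * u)) = of_real (exp (- (a / s)\<^sup>2 / 2)) / of_real s"
      using assms by simp
    then show ?thesis
      unfolding eq integral_mult_right_zero by (simp add: power_divide)
  qed
qed

lemma gaussian_wave_prod:
  "gaussian_wave c 0 w x = (\<Prod>b\<in>Basis. exp (of_real (- c * (x \<bullet> b)\<^sup>2) + \<i> * of_real ((w \<bullet> b) * (x \<bullet> b))))"
proof -
  have "x \<bullet> x = (\<Sum>b\<in>Basis. (x \<bullet> b)\<^sup>2)" "w \<bullet> x = (\<Sum>b\<in>Basis. (w \<bullet> b) * (x \<bullet> b))"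
    by (subst euclidean_inner, simp add: power2_eq_square)+
  then show ?thesis
    by (simp add: gaussian_wave_def sum.distrib sum_subtractf sum_negf sum_distrib_left flip: exp_sum)
qed

lemma integral_gaussian_wave:
  fixes w :: "'a::euclidean_space"
  assumes "s > 0"
  shows "integrable lborel (gaussian_wave (s\<^sup>2 / 2) 0 w)"
    and "(LINT x|lborel. gaussian_wave (s\<^sup>2 / 2) 0 w x)
           = of_real ((sqrt (2 * pi) / s) ^ DIM('a) * exp (- (norm w)\<^sup>2 / (2 * s\<^sup>2)))"
proof -
  have w: "(norm w)\<^sup>2 = (\<Sum>b\<in>Basis. (w \<bullet> b)\<^sup>2)"
    by (subst power2_norm_eq_inner, subst euclidean_inner, simp add: power2_eq_square)
  note F = fourier_gaussian_real[OF assms]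
  show "integrable lborel (gaussian_wave (s\<^sup>2 / 2) 0 w)"
    unfolding gaussian_wave_prod[abs_def] using F(1) by (intro integrable_lborel_prod_complex) simp
  show "(LINT x|lborel. gaussian_wave (s\<^sup>2 / 2) 0 w x)
           = of_real ((sqrt (2 * pi) / s) ^ DIM('a) * exp (- (norm w)\<^sup>2 / (2 * s\<^sup>2)))"
    unfolding gaussian_wave_prod using F
    by (subst integral_lborel_prod_complex)
       (simp_all add: prod.distrib w sum_divide_distrib exp_sum prod_dividef sum_negf[symmetric] power_divide flip: exp_of_real)
qed

text \<open>
  The density of the centred normal distribution with standard deviation \<open>\<epsilon>\<close> in each coordinate.
\<close>

definition heat_kernel :: "real \<Rightarrow> 'a::euclidean_space \<Rightarrow> real" where
  "heat_kernel \<epsilon> z = exp (- (norm z)\<^sup>2 / (2 * \<epsilon>\<^sup>2)) / (sqrt (2 * pi) * \<epsilon>) ^ DIM('a)"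

lemma fourier_gaussian_wave:
  fixes x :: "'a::euclidean_space"
  assumes "\<epsilon> > 0"
  shows "fourier (gaussian_wave (2 * pi\<^sup>2 * \<epsilon>\<^sup>2) 0 ((2 * pi) *\<^sub>R x)) y = of_real (heat_kernel \<epsilon> (y - x))"
proof -
  have s: "2 * pi * \<epsilon> > 0" using assms by simp
  have "fourier (gaussian_wave (2 * pi\<^sup>2 * \<epsilon>\<^sup>2) 0 ((2 * pi) *\<^sub>R x)) y
      = (LINT z|lborel. gaussian_wave ((2 * pi * \<epsilon>)\<^sup>2 / 2) 0 ((2 * pi) *\<^sub>R (x - y)) z)"
    unfolding fourier_def
    by (intro Bochner_Integration.integral_cong refl)
       (simp add: gaussian_wave_def mult_exp_exp inner_diff_left power_mult_distrib algebra_simps inner_commute[of y])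
  also have "\<dots> = of_real ((sqrt (2 * pi) / (2 * pi * \<epsilon>)) ^ DIM('a)
      * exp (- (norm ((2 * pi) *\<^sub>R (x - y)))\<^sup>2 / (2 * (2 * pi * \<epsilon>)\<^sup>2)))"
    by (rule integral_gaussian_wave(2)[OF s])
  also have "- (norm ((2 * pi) *\<^sub>R (x - y)))\<^sup>2 / (2 * (2 * pi * \<epsilon>)\<^sup>2) = - (norm (y - x))\<^sup>2 / (2 * \<epsilon>\<^sup>2)"
    using assms by (simp add: power_mult_distrib norm_minus_commute[of y])
  also have "sqrt (2 * pi) / (2 * pi * \<epsilon>) = 1 / (sqrt (2 * pi) * \<epsilon>)"
    using assms by (simp add: field_simps real_sqrt_mult)
  finally show ?thesis by (simp add: heat_kernel_def power_divide)
qed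

section \<open>A bump whose Fourier transform decays at a prescribed rate\<close>

text \<open>
  For positive \<open>n\<close> and \<open>\<kappa>\<close> this is \<open>cos (\<kappa> u) ^ n\<close> on its central arch and \<open>0\<close> outside. Clamping the argument makes continuity
  evident; the indicator form that is used for integration is \<open>cos_bump_eq_indicator\<close>.
\<close>

definition cos_bump :: "nat \<Rightarrow> real \<Rightarrow> real \<Rightarrow> real" where
  "cos_bump n \<kappa> u = cos (max (- (pi / 2)) (min (pi / 2) (\<kappa> * u))) ^ n"

lemma continuous_cos_bump: "continuous_on UNIV (cos_bump n \<kappa>)"
  unfolding cos_bump_def by (intro continuous_intros)

lemma cos_bump_bounds: "0 \<le> cos_bump n \<kappa> u" "cos_bump n \<kappa> u \<le> 1"
proof -
  define v where "v = max (- (pi / 2)) (min (pi / 2) (\<kappa> * u))"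
  have "- (pi / 2) \<le> v" "v \<le> pi / 2" using pi_gt_zero unfolding v_def by linarith+
  then have "0 \<le> cos v" by (intro cos_ge_zero)
  then show "0 \<le> cos_bump n \<kappa> u" "cos_bump n \<kappa> u \<le> 1"
    unfolding cos_bump_def v_def[symmetric] by (auto intro!: power_le_one)
qed

lemma cos_bump_0 [simp]: "cos_bump n \<kappa> 0 = 1"
  by (simp add: cos_bump_def)

lemma cos_bump_eq_indicator:
  assumes "n > 0" "\<kappa> > 0"
  shows "cos_bump n \<kappa> u = indicator {- (pi / (2 * \<kappa>))..pi / (2 * \<kappa>)} u * cos (\<kappa> * u) ^ n"
proof -
  have iff: "u \<in> {- (pi / (2 * \<kappa>))..pi / (2 * \<kappa>)} \<longleftrightarrow> - (pi / 2) \<le> \<kappa> * u \<and> \<kappa> * u \<le> pi / 2"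
    using assms by (auto simp: field_simps)
  consider "\<kappa> * u > pi / 2" | "\<kappa> * u < - (pi / 2)" | "- (pi / 2) \<le> \<kappa> * u \<and> \<kappa> * u \<le> pi / 2" by linarith
  then show ?thesis
  proof cases
    case 1
    then have "max (- (pi / 2)) (min (pi / 2) (\<kappa> * u)) = pi / 2" using pi_gt_zero by linarith
    with 1 iff assms show ?thesis by (simp add: cos_bump_def zero_power)
  next
    case 2
    then have "max (- (pi / 2)) (min (pi / 2) (\<kappa> * u)) = - (pi / 2)" using pi_gt_zero by linarith
    with 2 iff assms show ?thesis by (simp add: cos_bump_def zero_power)
  next
    case 3
    then have "max (- (pi / 2)) (min (pi / 2) (\<kappa> * u)) = \<kappa> * u" by linarith
    with 3 iff show ?thesis by (simp add: cos_bump_def)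
  qed
qed

definition cos_bump_fourier :: "nat \<Rightarrow> real \<Rightarrow> real \<Rightarrow> complex" where
  "cos_bump_fourier n \<kappa> \<xi> = (LINT u|lborel. of_real (cos_bump n \<kappa> u) * exp (\<i> * of_real (\<xi> * u)))"

lemma integrable_cos_bump_wave:
  assumes "n > 0" "\<kappa> > 0"
  shows "integrable lborel (\<lambda>u. of_real (cos_bump n \<kappa> u) * exp (\<i> * of_real (\<xi> * u)) :: complex)"
proof -
  have "integrable lborel (\<lambda>u. indicator {- (pi / (2 * \<kappa>))..pi / (2 * \<kappa>)} u *\<^sub>R
          (of_real (cos (\<kappa> * u) ^ n) * exp (\<i> * of_real (\<xi> * u)) :: complex))"
    by (intro borel_integrable_compact continuous_intros) auto
  then show ?thesis
    by (rule Bochner_Integration.integrable_cong[THEN iffD1, rotated -1])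
       (auto simp: cos_bump_eq_indicator[OF assms] indicator_def)
qed

lemma cos_bump_fourier_bounded:
  assumes "n > 0" "\<kappa> > 0"
  shows "norm (cos_bump_fourier n \<kappa> \<xi>) \<le> pi / \<kappa>"
proof -
  let ?I = "{- (pi / (2 * \<kappa>))..pi / (2 * \<kappa>)}"
  have "norm (cos_bump_fourier n \<kappa> \<xi>) \<le> (LINT u|lborel. indicator ?I u)"
    unfolding cos_bump_fourier_def
  proof (rule order_trans[OF integral_norm_bound integral_mono])
    show "integrable lborel (\<lambda>u. norm (of_real (cos_bump n \<kappa> u) * exp (\<i> * of_real (\<xi> * u)) :: complex))"
      by (intro integrable_norm integrable_cos_bump_wave assms)
    show "integrable lborel (indicator ?I :: real \<Rightarrow> real)"
      by (rule integrable_real_indicator) (auto simp: emeasure_lborel_Icc_eq)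
    show "norm (of_real (cos_bump n \<kappa> u) * exp (\<i> * of_real (\<xi> * u)) :: complex) \<le> indicator ?I u" for u
      using cos_bump_bounds[of n \<kappa> u]
      by (auto simp: norm_mult cos_bump_eq_indicator[OF assms] indicator_def simp del: of_real_power)
  qed
  also have "\<dots> = pi / \<kappa>" using assms by (simp add: measure_def field_simps)
  finally show ?thesis .
qed

text \<open>
  For \<open>f = cos (\<kappa> u) ^ n\<close> one has \<open>f'' = - n\<^sup>2 \<kappa>\<^sup>2 f + n (n - 1) \<kappa>\<^sup>2 cos (\<kappa> u) ^ (n - 2)\<close>. As \<open>f\<close> and \<open>f'\<close>
  vanish at both ends of the arch, two integrations by parts replace \<open>f''\<close> by \<open>- \<xi>\<^sup>2 f\<close> under the
  Fourier integral.
\<close>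

lemma cos_bump_fourier_recurrence:
  assumes "n \<ge> 3" "\<kappa> > 0"
  shows "of_real (\<xi>\<^sup>2) * cos_bump_fourier n \<kappa> \<xi> =
           of_real ((real n)\<^sup>2 * \<kappa>\<^sup>2) * cos_bump_fourier n \<kappa> \<xi>
           - of_real (real n * real (n - 1) * \<kappa>\<^sup>2) * cos_bump_fourier (n - 2) \<kappa> \<xi>"
proof -
  define m where "m = n - 3"
  have m: "n = Suc (Suc (Suc m))" using assms(1) by (simp add: m_def)
  define A where "A = pi / (2 * \<kappa>)"
  have A: "A > 0" "\<kappa> * A = pi / 2" using assms by (auto simp: A_def)
  define e where "e u = exp (\<i> * of_real (\<xi> * u))" for u
  \<comment> \<open>This is \<open>(f' - i \<xi> f) e\<close>, an antiderivative of \<open>(f'' + \<xi>\<^sup>2 f) e\<close>.\<close>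
  define F where "F u = (of_real (- real n * \<kappa> * cos (\<kappa> * u) ^ (n - 1) * sin (\<kappa> * u))
      - \<i> * of_real \<xi> * of_real (cos (\<kappa> * u) ^ n)) * e u" for u
  define f where "f u = of_real (\<xi>\<^sup>2 - (real n)\<^sup>2 * \<kappa>\<^sup>2) * (of_real (cos (\<kappa> * u) ^ n) * e u)
      + of_real (real n * real (n - 1) * \<kappa>\<^sup>2) * (of_real (cos (\<kappa> * u) ^ (n - 2)) * e u)" for u
  have dF: "(F has_vector_derivative f u) (at u within S)" for u S
  proof -
    define c s where "c = cos (\<kappa> * u)" and "s = sin (\<kappa> * u)"
    define p' where "p' = - (real n)\<^sup>2 * \<kappa>\<^sup>2 * c ^ n + real n * real (n - 1) * \<kappa>\<^sup>2 * c ^ (n - 2)"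
    define q' where "q' = - real n * \<kappa> * c ^ (n - 1) * s"
    have s2: "s * s = 1 - c * c"
      using sin_cos_squared_add[of "\<kappa> * u"] by (simp add: power2_eq_square c_def s_def algebra_simps)
    have dc: "((\<lambda>u. cos (\<kappa> * u)) has_real_derivative - \<kappa> * s) (at u within S)"
      unfolding s_def by (auto intro!: derivative_eq_intros)
    have "((\<lambda>u. cos (\<kappa> * u) ^ (m + 2)) has_real_derivative - real (m + 2) * \<kappa> * c ^ (m + 1) * s) (at u within S)"
      by (rule DERIV_cong[OF DERIV_power[OF dc]]) (simp add: c_def algebra_simps)
    moreover have "((\<lambda>u. sin (\<kappa> * u)) has_real_derivative \<kappa> * c) (at u within S)"
      unfolding c_def by (auto intro!: derivative_eq_intros)
    ultimately have "((\<lambda>u. - real n * \<kappa> * (cos (\<kappa> * u) ^ (m + 2) * sin (\<kappa> * u))) has_real_derivative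
        - real n * \<kappa> * (- real (m + 2) * \<kappa> * c ^ (m + 1) * s * s + \<kappa> * c * c ^ (m + 2))) (at u within S)"
      unfolding c_def s_def by (intro DERIV_cmult DERIV_mult)
    moreover have "- real n * \<kappa> * (- real (m + 2) * \<kappa> * c ^ (m + 1) * s * s + \<kappa> * c * c ^ (m + 2)) = p'"
      unfolding mult.assoc[of _ s s] s2 p'_def by (simp add: m algebra_simps power2_eq_square)
    ultimately have 1: "((\<lambda>u. - real n * \<kappa> * cos (\<kappa> * u) ^ (n - 1) * sin (\<kappa> * u)) has_real_derivative p') (at u within S)"
      by (simp add: m mult.assoc)
    have 2: "((\<lambda>u. cos (\<kappa> * u) ^ n) has_real_derivative q') (at u within S)"
      by (rule DERIV_cong[OF DERIV_power[OF dc]]) (simp add: q'_def c_def)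
    have "((\<lambda>z. exp (\<i> * (of_real \<xi> * z))) has_field_derivative (\<i> * of_real \<xi> * e u)) (at (of_real u))"
      unfolding e_def by (auto intro!: derivative_eq_intros)
    from has_vector_derivative_real_field[OF this, of S]
    have 3: "(e has_vector_derivative (\<i> * of_real \<xi> * e u)) (at u within S)"
      by (simp add: e_def[abs_def])
    have 4: "((\<lambda>u. of_real (- real n * \<kappa> * cos (\<kappa> * u) ^ (n - 1) * sin (\<kappa> * u))
      - \<i> * of_real \<xi> * of_real (cos (\<kappa> * u) ^ n)) has_vector_derivative
        (of_real p' - \<i> * of_real \<xi> * of_real q')) (at u within S)"
      by (intro has_vector_derivative_diff has_vector_derivative_mult_right has_vector_derivative_of_real 1 2)
    have "(of_real q' - \<i> * of_real \<xi> * of_real (c ^ n)) * (\<i> * of_real \<xi> * e u)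
            + (of_real p' - \<i> * of_real \<xi> * of_real q') * e u = (of_real p' + of_real (\<xi>\<^sup>2) * of_real (c ^ n)) * e u"
      by (simp add: algebra_simps power2_eq_square)
    also have "\<dots> = f u"
      unfolding f_def p'_def c_def[symmetric] by (simp add: algebra_simps)
    finally show ?thesis
      using has_vector_derivative_mult[OF 4 3] unfolding F_def q'_def c_def s_def by simp
  qed
  have "continuous_on {- A..A} f"
    unfolding f_def e_def by (intro continuous_intros)
  with A dF have hb: "has_bochner_integral lborel (\<lambda>u. indicator {- A..A} u *\<^sub>R f u) (F A - F (- A))"
    by (intro has_bochner_integral_FTC_Icc) auto
  have "cos (\<kappa> * A) = 0" unfolding A(2) by (rule cos_pi_half)
  then have "F A = 0" "F (- A) = 0" by (simp_all add: F_def m)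
  with hb have "(LINT u|lborel. indicator {- A..A} u *\<^sub>R f u) = 0"
    by (simp add: has_bochner_integral_iff)
  moreover have "indicator {- A..A} u *\<^sub>R f u =
      of_real (\<xi>\<^sup>2 - (real n)\<^sup>2 * \<kappa>\<^sup>2) * (of_real (cos_bump n \<kappa> u) * exp (\<i> * of_real (\<xi> * u)))
      + of_real (real n * real (n - 1) * \<kappa>\<^sup>2) * (of_real (cos_bump (n - 2) \<kappa> u) * exp (\<i> * of_real (\<xi> * u)))" for u
    using assms by (simp add: cos_bump_eq_indicator f_def e_def A_def indicator_def)
  ultimately have "of_real (\<xi>\<^sup>2 - (real n)\<^sup>2 * \<kappa>\<^sup>2) * cos_bump_fourier n \<kappa> \<xi>
      + of_real (real n * real (n - 1) * \<kappa>\<^sup>2) * cos_bump_fourier (n - 2) \<kappa> \<xi> = 0"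
    using integrable_cos_bump_wave[of n \<kappa> \<xi>] integrable_cos_bump_wave[of "n - 2" \<kappa> \<xi>] assms
    unfolding cos_bump_fourier_def by simp
  then show ?thesis by (simp add: algebra_simps) 
qed

text \<open>
  By the recurrence, a factor \<open>\<xi>\<^sup>2\<close> on the transform with exponent \<open>n\<close> costs only the transforms with
  exponents \<open>n\<close> and \<open>n - 2\<close>. So each factor \<open>1 + \<xi>\<^sup>2\<close> uses up two units of \<open>n\<close>, and the base case is
  boundedness.
\<close>

lemma cos_bump_fourier_decay:
  assumes "\<kappa> > 0"
  shows "n \<ge> 2 * K + 1 \<Longrightarrow> \<exists>C\<ge>0. \<forall>\<xi>. (1 + \<xi>\<^sup>2) ^ K * norm (cos_bump_fourier n \<kappa> \<xi>) \<le> C"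
proof (induction K arbitrary: n)
  case 0
  have "pi / \<kappa> \<ge> 0" using assms by simp
  with 0 cos_bump_fourier_bounded[of n \<kappa>] assms show ?case by (intro exI[of _ "pi / \<kappa>"]) auto
next
  case (Suc K)
  obtain C where C: "C \<ge> 0" "\<And>\<xi>. (1 + \<xi>\<^sup>2) ^ K * norm (cos_bump_fourier n \<kappa> \<xi>) \<le> C"
    using Suc.IH[of n] Suc.prems by auto
  obtain D where D: "D \<ge> 0" "\<And>\<xi>. (1 + \<xi>\<^sup>2) ^ K * norm (cos_bump_fourier (n - 2) \<kappa> \<xi>) \<le> D"
  proof -
    have "2 * K + 1 \<le> n - 2" using Suc.prems by simp
    from Suc.IH[OF this] show thesis using that by blast
  qed
  define a b where "a = (real n)\<^sup>2 * \<kappa>\<^sup>2" and "b = real n * real (n - 1) * \<kappa>\<^sup>2"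
  have ab: "a \<ge> 0" "b \<ge> 0" by (auto simp: a_def b_def)
  have "(1 + \<xi>\<^sup>2) ^ Suc K * norm (cos_bump_fourier n \<kappa> \<xi>) \<le> C + a * C + b * D" for \<xi>
  proof -
    let ?I = "cos_bump_fourier n \<kappa> \<xi>" and ?J = "cos_bump_fourier (n - 2) \<kappa> \<xi>"
    have "\<xi>\<^sup>2 * norm ?I = norm (of_real (\<xi>\<^sup>2) * ?I)" by (simp add: norm_mult norm_power)
    also have "\<dots> = norm (of_real a * ?I - of_real b * ?J)"
      unfolding a_def b_def using cos_bump_fourier_recurrence[of n \<kappa> \<xi>] Suc.prems assms by simp
    also have "\<dots> \<le> a * norm ?I + b * norm ?J"
      using norm_triangle_ineq4[of "of_real a * ?I" "of_real b * ?J"] ab by (simp add: norm_mult)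
    finally have "(1 + \<xi>\<^sup>2) * norm ?I \<le> norm ?I + a * norm ?I + b * norm ?J" by (simp add: algebra_simps)
    then have "(1 + \<xi>\<^sup>2) ^ K * ((1 + \<xi>\<^sup>2) * norm ?I) \<le> (1 + \<xi>\<^sup>2) ^ K * (norm ?I + a * norm ?I + b * norm ?J)"
      by (intro mult_left_mono) auto
    also have "\<dots> = (1 + \<xi>\<^sup>2) ^ K * norm ?I + a * ((1 + \<xi>\<^sup>2) ^ K * norm ?I) + b * ((1 + \<xi>\<^sup>2) ^ K * norm ?J)"
      by (simp add: algebra_simps)
    also have "\<dots> \<le> C + a * C + b * D"
      by (intro add_mono mult_left_mono C D ab)
    finally show ?thesis by (simp add: algebra_simps)
  qed
  moreover have "C + a * C + b * D \<ge> 0" using C D ab by simp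
  ultimately show ?case by blast
qed

definition cube_bump :: "nat \<Rightarrow> real \<Rightarrow> 'a::euclidean_space \<Rightarrow> real" where
  "cube_bump n \<kappa> x = (\<Prod>b\<in>Basis. cos_bump n \<kappa> (x \<bullet> b))"

lemma continuous_cube_bump: "continuous_on UNIV (cube_bump n \<kappa>)"
proof -
  have "continuous_on UNIV (\<lambda>x::'a. cos_bump n \<kappa> (x \<bullet> b))" for b
    by (rule continuous_on_compose2[OF continuous_cos_bump]) (auto intro!: continuous_intros)
  then show ?thesis unfolding cube_bump_def by (intro continuous_intros)
qed

lemma cube_bump_bounds: "0 \<le> cube_bump n \<kappa> x" "cube_bump n \<kappa> x \<le> 1"
  unfolding cube_bump_def by (auto intro!: prod_nonneg prod_le_1 cos_bump_bounds)

lemma cube_bump_0 [simp]: "cube_bump n \<kappa> 0 = 1"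
  by (simp add: cube_bump_def)

lemma cube_bump_support:
  fixes x :: "'a::euclidean_space"
  assumes "n > 0" "\<kappa> > 0" "cube_bump n \<kappa> x \<noteq> 0"
  shows "norm x \<le> real DIM('a) * pi / (2 * \<kappa>)"
proof -
  have "\<bar>x \<bullet> b\<bar> \<le> pi / (2 * \<kappa>)" if "b \<in> Basis" for b
  proof -
    have "cos_bump n \<kappa> (x \<bullet> b) \<noteq> 0" using assms(3) that by (simp add: cube_bump_def)
    then show ?thesis using assms by (auto simp: cos_bump_eq_indicator indicator_def split: if_splits)
  qed
  then have "(\<Sum>b\<in>Basis. \<bar>x \<bullet> b\<bar>) \<le> real DIM('a) * (pi / (2 * \<kappa>))"
    using sum_bounded_above[of Basis "\<lambda>b. \<bar>x \<bullet> b\<bar>" "pi / (2 * \<kappa>)"] by simp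
  with norm_le_l1[of x] show ?thesis by simp
qed

definition cube_bump_fourier :: "nat \<Rightarrow> real \<Rightarrow> 'a::euclidean_space \<Rightarrow> complex" where
  "cube_bump_fourier n \<kappa> w = (\<Prod>b\<in>Basis. cos_bump_fourier n \<kappa> (w \<bullet> b))"

lemma cube_bump_wave_prod:
  "of_real (cube_bump n \<kappa> x) * exp (\<i> * of_real (w \<bullet> x)) =
     (\<Prod>b\<in>Basis. of_real (cos_bump n \<kappa> (x \<bullet> b)) * exp (\<i> * of_real ((w \<bullet> b) * (x \<bullet> b))))"
proof -
  have "w \<bullet> x = (\<Sum>b\<in>Basis. (w \<bullet> b) * (x \<bullet> b))" by (rule euclidean_inner)
  then show ?thesis
    by (simp add: cube_bump_def prod.distrib sum_distrib_left flip: exp_sum)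
qed

lemma integral_cube_bump_wave:
  assumes "n > 0" "\<kappa> > 0"
  shows "integrable lborel (\<lambda>x. of_real (cube_bump n \<kappa> x) * exp (\<i> * of_real (w \<bullet> x)) :: complex)"
    and "(LINT x|lborel. of_real (cube_bump n \<kappa> x) * exp (\<i> * of_real (w \<bullet> x))) = cube_bump_fourier n \<kappa> w"
proof -
  have *: "integrable lborel (\<lambda>u. of_real (cos_bump n \<kappa> u) * exp (\<i> * of_real ((w \<bullet> b) * u)) :: complex)" for b
    by (rule integrable_cos_bump_wave[OF assms])
  show "integrable lborel (\<lambda>x. of_real (cube_bump n \<kappa> x) * exp (\<i> * of_real (w \<bullet> x)) :: complex)"
    unfolding cube_bump_wave_prod by (rule integrable_lborel_prod_complex[OF *])
  show "(LINT x|lborel. of_real (cube_bump n \<kappa> x) * exp (\<i> * of_real (w \<bullet> x))) = cube_bump_fourier n \<kappa> w"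
    unfolding cube_bump_wave_prod
    by (subst integral_lborel_prod_complex[OF *]) (simp_all add: cube_bump_fourier_def cos_bump_fourier_def)
qed

lemma one_plus_norm_power2_le_prod:
  fixes w :: "'a::euclidean_space"
  shows "1 + (norm w)\<^sup>2 \<le> (\<Prod>b\<in>Basis. 1 + (w \<bullet> b)\<^sup>2)"
proof -
  have "1 + (\<Sum>b\<in>S. (w \<bullet> b)\<^sup>2) \<le> (\<Prod>b\<in>S. 1 + (w \<bullet> b)\<^sup>2)" if "finite S" for S
    using that
  proof induction
    case (insert b S)
    have "(w \<bullet> b)\<^sup>2 * 1 \<le> (w \<bullet> b)\<^sup>2 * (\<Prod>b\<in>S. 1 + (w \<bullet> b)\<^sup>2)"
      by (intro mult_left_mono prod_ge_1) auto
    with insert show ?case by (simp add: distrib_right)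
  qed simp
  from this[OF finite_Basis] show ?thesis
    by (subst power2_norm_eq_inner, subst euclidean_inner) (simp add: power2_eq_square)
qed

text \<open>
  The transform of a product bump is a product, and \<open>1 + (norm w)\<^sup>2\<close> is dominated by the product of the
  one-dimensional factors \<open>1 + (w \<bullet> b)\<^sup>2\<close>.
\<close>

lemma cube_bump_fourier_decay:
  assumes "\<kappa> > 0" "n \<ge> 2 * K + 1"
  shows "\<exists>C\<ge>0. \<forall>w::'a::euclidean_space. (1 + (norm w)\<^sup>2) ^ K * norm (cube_bump_fourier n \<kappa> w) \<le> C"
proof -
  obtain C where C: "C \<ge> 0" "\<And>\<xi>. (1 + \<xi>\<^sup>2) ^ K * norm (cos_bump_fourier n \<kappa> \<xi>) \<le> C"
    using cos_bump_fourier_decay[OF assms] by auto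
  have "(1 + (norm w)\<^sup>2) ^ K * norm (cube_bump_fourier n \<kappa> w) \<le> C ^ DIM('a)" for w :: 'a
  proof -
    have "(1 + (norm w)\<^sup>2) ^ K \<le> (\<Prod>b\<in>Basis. 1 + (w \<bullet> b)\<^sup>2) ^ K"
      by (intro power_mono one_plus_norm_power2_le_prod) auto
    then have "(1 + (norm w)\<^sup>2) ^ K * norm (cube_bump_fourier n \<kappa> w)
        \<le> (\<Prod>b\<in>Basis. (1 + (w \<bullet> b)\<^sup>2) ^ K * norm (cos_bump_fourier n \<kappa> (w \<bullet> b)))"
      by (simp add: cube_bump_fourier_def prod.distrib prod_power_distrib prod_norm[symmetric] mult_right_mono prod_nonneg)
    also have "\<dots> \<le> (\<Prod>b\<in>(Basis::'a set). C)"
      by (intro prod_mono) (use C in auto)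
    finally show ?thesis by simp
  qed
  with C(1) show ?thesis by (intro exI[of _ "C ^ DIM('a)"]) auto
qed

section \<open>Sums, integrals and dominated convergence\<close>

text \<open>
  Complex sums are absolutely convergent, hence integrals over a counting measure. This makes
  Fubini's theorem and dominated convergence available for them.
\<close>

lemma has_sum_complex_count_space:
  fixes f :: "'i \<Rightarrow> complex"
  shows "(f has_sum S) A \<longleftrightarrow> integrable (count_space A) f \<and> (\<integral>i. f i \<partial>count_space A) = S"
proof -
  have "f summable_on A \<longleftrightarrow> integrable (count_space A) f"
    using summable_on_iff_abs_summable_on_complex[of f A] abs_summable_equivalent[of f A]
    by (simp add: abs_summable_on_def)
  moreover have "infsum f A = (\<integral>i. f i \<partial>count_space A)" if "integrable (count_space A) f"
    using infsetsum_infsum[of f A] that by (simp add: abs_summable_on_def infsetsum_def)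
  ultimately show ?thesis
    by (auto simp: has_sum_iff)
qed

lemma summable_on_real_count_space:
  fixes h :: "'i \<Rightarrow> real"
  shows "h summable_on A \<longleftrightarrow> integrable (count_space A) h"
  using summable_on_iff_abs_summable_on_real[of h A] abs_summable_equivalent[of h A]
  by (simp add: abs_summable_on_def)

text \<open>
  Fubini's theorem for the product of a counting measure and Lebesgue measure.
\<close>

lemma has_sum_integral:
  fixes F :: "'i \<Rightarrow> 'b::euclidean_space \<Rightarrow> complex"
  assumes "countable A"
    and int: "\<And>i. i \<in> A \<Longrightarrow> integrable lborel (F i)"
    and sum: "(\<lambda>i. LINT v|lborel. norm (F i v)) summable_on A"
    and S: "\<And>v. ((\<lambda>i. F i v) has_sum S v) A"
  shows "((\<lambda>i. LINT v|lborel. F i v) has_sum (LINT v|lborel. S v)) A"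
proof -
  let ?f = "\<lambda>(i, v). F i v"
  interpret pair_sigma_finite "count_space A" "lborel :: 'b measure"
    by (intro pair_sigma_finite.intro sigma_finite_measure_count_space_countable assms lborel.sigma_finite_measure_axioms)
  have "?f \<in> borel_measurable (count_space A \<Otimes>\<^sub>M lborel)"
    by (rule measurable_pair_measure_countable1[OF assms(1)]) (use int in auto)
  moreover have "integrable (count_space A) (\<lambda>i. LINT v|lborel. norm (F i v))"
    using sum by (simp add: summable_on_real_count_space)
  moreover have "AE i in count_space A. integrable lborel (F i)"
    using int by (simp add: AE_count_space)
  ultimately have I: "integrable (count_space A \<Otimes>\<^sub>M lborel) ?f"
    by (intro Fubini_integrable) auto
  have "(LINT v|lborel. S v) = (LINT v|lborel. \<integral>i. F i v \<partial>count_space A)"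
    using S by (simp add: has_sum_complex_count_space)
  also have "\<dots> = (\<integral>i. (LINT v|lborel. F i v) \<partial>count_space A)"
    using Fubini_integral[OF I] by simp
  finally show ?thesis
    using integrable_fst[OF I] by (simp add: has_sum_complex_count_space)
qed

lemma has_sum_dominated_convergence:
  fixes f :: "nat \<Rightarrow> 'i \<Rightarrow> complex" and h :: "'i \<Rightarrow> real"
  assumes "\<And>i. i \<in> A \<Longrightarrow> (\<lambda>n. f n i) \<longlonglongrightarrow> g i"
    and "\<And>n i. i \<in> A \<Longrightarrow> norm (f n i) \<le> h i" and "h summable_on A"
    and "\<And>n. (f n has_sum S n) A"
  shows "g summable_on A" and "S \<longlonglongrightarrow> infsum g A"
proof -
  have h: "integrable (count_space A) h" using assms(3) by (simp add: summable_on_real_count_space)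
  have 1: "AE i in count_space A. (\<lambda>n. f n i) \<longlonglongrightarrow> g i" using assms(1) by (simp add: AE_count_space)
  have 2: "AE i in count_space A. norm (f n i) \<le> h i" for n using assms(2) by (simp add: AE_count_space)
  have g: "integrable (count_space A) g"
    by (rule integrable_dominated_convergence[OF _ _ h 1 2]) auto
  then have "(g has_sum (\<integral>i. g i \<partial>count_space A)) A" by (simp add: has_sum_complex_count_space)
  then show "g summable_on A" and "S \<longlonglongrightarrow> infsum g A"
    using integral_dominated_convergence[OF _ _ h 1 2] assms(4)
    by (auto simp: has_sum_complex_count_space has_sum_imp_summable infsumI)
qed

text \<open>
  Split \<open>\<Gamma>\<close> into the shells \<open>k \<le> norm z < k + 1\<close>. The masses on the \<open>k\<close>-th shell add up to
  \<open>O((k + 2) ^ N)\<close>, while the weight there is at most \<open>(1 + k\<^sup>2) ^ - (N + 1)\<close>; since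
  \<open>k + 2 \<le> 2 (1 + k\<^sup>2)\<close>, the shell contributes \<open>O(1 / (1 + k\<^sup>2))\<close>.
\<close>

lemma summable_on_polynomial_decay:
  fixes b :: "'a::euclidean_space \<Rightarrow> complex"
  assumes sum: "\<And>r. (\<lambda>z. norm (b z)) summable_on (\<Gamma> \<inter> ball 0 r)"
    and growth: "(\<lambda>r::real. \<Sum>\<^sub>\<infinity>z\<in>\<Gamma> \<inter> ball 0 r. norm (b z)) \<in> O[at_top](\<lambda>r. r ^ N)"
  shows "(\<lambda>z. norm (b z) / (1 + (norm z)\<^sup>2) ^ (N + 1)) summable_on \<Gamma>"
proof -
  define S where "S r = (\<Sum>\<^sub>\<infinity>z\<in>\<Gamma> \<inter> ball 0 r. norm (b z))" for r
  have S_fin: "(\<Sum>z\<in>F. norm (b z)) \<le> S r" if "finite F" "F \<subseteq> \<Gamma> \<inter> ball 0 r" for F r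
    unfolding S_def by (rule finite_sum_le_infsum[OF sum that]) auto
  have S_mono: "S r \<le> S r'" if "r \<le> r'" for r r'
    unfolding S_def by (rule infsum_mono_neutral[OF sum sum]) (use that in auto)
  obtain c where c: "c > 0" "\<forall>\<^sub>F r in at_top. norm (S r) \<le> c * norm (r ^ N)"
    using landau_o.bigE[OF growth] unfolding S_def by blast
  then obtain R where R: "\<And>r. r \<ge> R \<Longrightarrow> norm (S r) \<le> c * norm (r ^ N)"
    unfolding eventually_at_top_linorder by blast
  define C where "C = c * (1 + \<bar>R\<bar>) ^ N"
  have C: "C > 0" using c(1) by (auto simp: C_def intro!: mult_pos_pos zero_less_power)
  have S_le: "S r \<le> C * (1 + r) ^ N" if "r \<ge> 0" for r
  proof -
    \<comment> \<open>The growth bound holds only beyond \<open>R\<close>; monotonicity extends it to small radii.\<close>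
    let ?m = "max r \<bar>R\<bar>"
    have "0 \<le> r * \<bar>R\<bar>" using that by simp
    then have m: "0 \<le> ?m" "?m \<le> (1 + \<bar>R\<bar>) * (1 + r)"
      using that unfolding distrib_left distrib_right by (auto simp: mult.commute)
    have "S r \<le> S ?m" by (rule S_mono) simp
    also have "\<dots> \<le> norm (S ?m)" by simp
    also have "\<dots> \<le> c * norm (?m ^ N)" by (rule R) linarith
    also have "\<dots> = c * ?m ^ N" using m(1) by (simp only: real_norm_def power_abs abs_of_nonneg)
    also have "\<dots> \<le> c * ((1 + \<bar>R\<bar>) * (1 + r)) ^ N"
      using c(1) m by (intro mult_left_mono power_mono) auto
    finally show ?thesis by (simp add: C_def power_mult_distrib mult.assoc)
  qed
  let ?h = "\<lambda>z. norm (b z) / (1 + (norm z)\<^sup>2) ^ (N + 1)"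
  define w where "w k = inverse (1 + (real k)\<^sup>2)" for k
  have w_nonneg: "0 \<le> w k" for k by (simp add: w_def)
  have w: "summable w"
  proof (rule summable_comparison_test')
    show "summable (\<lambda>k. inverse (real k ^ 2))" by (rule inverse_power_summable) simp
    show "norm (w k) \<le> inverse (real k ^ 2)" if "k \<ge> 1" for k
      using that unfolding w_def by (simp add: le_imp_inverse_le)
  qed
  have shell: "(\<Sum>z\<in>F. ?h z) \<le> C * 2 ^ N * w k"
    if F: "finite F" "F \<subseteq> \<Gamma>" "\<And>z. z \<in> F \<Longrightarrow> real k \<le> norm z \<and> norm z < real k + 1" for F k
  proof -
    let ?q = "1 + (real k)\<^sup>2"
    have q: "?q > 0" by (simp add: add_pos_nonneg)
    have "(\<Sum>z\<in>F. ?h z) \<le> (\<Sum>z\<in>F. norm (b z) / ?q ^ (N + 1))"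
    proof (rule sum_mono)
      fix z assume "z \<in> F"
      then have "?q ^ (N + 1) \<le> (1 + (norm z)\<^sup>2) ^ (N + 1)" using F(3) by (intro power_mono add_mono) auto
      then show "?h z \<le> norm (b z) / ?q ^ (N + 1)" using q by (intro divide_left_mono mult_pos_pos zero_less_power add_pos_nonneg) auto
    qed
    also have "\<dots> = (\<Sum>z\<in>F. norm (b z)) / ?q ^ (N + 1)" by (simp add: sum_divide_distrib)
    also have "\<dots> \<le> (C * (real k + 2) ^ N) / ?q ^ (N + 1)"
    proof (intro divide_right_mono)
      have "(\<Sum>z\<in>F. norm (b z)) \<le> S (real k + 1)" by (rule S_fin) (use F in auto)
      also have "\<dots> \<le> C * (1 + (real k + 1)) ^ N" by (rule S_le) simp
      finally show "(\<Sum>z\<in>F. norm (b z)) \<le> C * (real k + 2) ^ N" by (simp add: add.commute)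
    qed (use q in simp)
    also have "\<dots> \<le> (C * (2 * ?q) ^ N) / ?q ^ (N + 1)"
    proof (intro divide_right_mono mult_left_mono power_mono)
      have "real k \<le> (real k)\<^sup>2" by (cases k) (simp_all add: power2_eq_square)
      then have "real k \<le> (real k)\<^sup>2 + (real k)\<^sup>2" using zero_le_power2[of "real k"] by (rule add_increasing2[rotated])
      then show "real k + 2 \<le> 2 * ?q" unfolding distrib_left mult_2 by simp
    qed (use C q in auto)
    also have "\<dots> = C * 2 ^ N * w k"
    proof -
      have "(C * (2 * q) ^ N) / q ^ (N + 1) = C * 2 ^ N * inverse q" if "q > 0" for q
        using that by (simp add: power_mult_distrib field_simps)
      from this[OF q] show ?thesis unfolding w_def .
    qed
    finally show ?thesis .
  qed
  show ?thesis
  proof (rule nonneg_bounded_partial_sums_imp_summable_on)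
    show "\<forall>\<^sub>F F in finite_subsets_at_top \<Gamma>. sum ?h F \<le> C * 2 ^ N * suminf w"
    proof (rule eventually_finite_subsets_at_top_weakI)
      fix F assume F: "finite F" "F \<subseteq> \<Gamma>"
      let ?g = "\<lambda>z::'a. nat \<lfloor>norm z\<rfloor>"
      have "sum ?h F = (\<Sum>k\<in>?g ` F. \<Sum>z\<in>{z \<in> F. ?g z = k}. ?h z)"
        by (rule sum.group[symmetric]) (use F in auto)
      also have "\<dots> \<le> (\<Sum>k\<in>?g ` F. C * 2 ^ N * w k)"
      proof (intro sum_mono shell)
        fix k z assume "z \<in> {z \<in> F. ?g z = k}"
        then have "real k = of_int \<lfloor>norm z\<rfloor>" by auto
        then show "real k \<le> norm z \<and> norm z < real k + 1" by linarith
      qed (use F in auto)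
      also have "\<dots> = C * 2 ^ N * (\<Sum>k\<in>?g ` F. w k)" by (simp add: sum_distrib_left)
      also have "\<dots> \<le> C * 2 ^ N * suminf w"
        using C w w_nonneg F by (intro mult_left_mono sum_le_suminf) auto
      finally show "sum ?h F \<le> C * 2 ^ N * suminf w" .
    qed
  qed auto
qed

section \<open>Smoothing by the heat kernel\<close>

lemma integrable_gaussian:
  assumes "c > 0"
  shows "integrable lborel (\<lambda>u::'a::euclidean_space. exp (- c * (norm u)\<^sup>2))"
proof -
  have "integrable lborel (gaussian_wave ((sqrt (2 * c))\<^sup>2 / 2) 0 (0::'a))"
    by (rule integral_gaussian_wave) (use assms in simp)
  from integrable_norm[OF this] show ?thesis
    using assms by (simp add: norm_gaussian_wave)
qed

lemma integral_standard_gaussian: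
  "(LINT u::'a::euclidean_space|lborel. exp (- (norm u)\<^sup>2 / 2)) = sqrt (2 * pi) ^ DIM('a)"
proof -
  have "(LINT u::'a|lborel. gaussian_wave (1\<^sup>2 / 2) 0 0 u) = of_real ((sqrt (2 * pi) / 1) ^ DIM('a) * exp (- (norm (0::'a))\<^sup>2 / (2 * 1\<^sup>2)))"
    by (rule integral_gaussian_wave) simp
  moreover have "gaussian_wave (1\<^sup>2 / 2) 0 0 u = of_real (exp (- (norm u)\<^sup>2 / 2))" for u :: 'a
    by (simp add: gaussian_wave_def power2_norm_eq_inner flip: exp_of_real)
  ultimately have "complex_of_real (LINT u::'a|lborel. exp (- (norm u)\<^sup>2 / 2)) = of_real (sqrt (2 * pi) ^ DIM('a))"
    by (simp flip: integral_complex_of_real of_real_power)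
  then show ?thesis by (simp only: of_real_eq_iff)
qed

lemma integral_lborel_affine_euclidean:
  fixes f :: "'a::euclidean_space \<Rightarrow> real"
  assumes [measurable]: "f \<in> borel_measurable borel" and "c \<noteq> 0"
  shows "(LINT v|lborel. f v) = \<bar>c\<bar> ^ DIM('a) * (LINT u|lborel. f (y + c *\<^sub>R u))"
proof -
  have "(LINT v|lborel. f v)
      = (LINT v|density (distr lborel borel (\<lambda>u. y + c *\<^sub>R u)) (\<lambda>_. ennreal (\<bar>c\<bar> ^ DIM('a))). f v)"
    by (subst lborel_affine[OF assms(2), of y]) (simp add: ennreal_power)
  also have "\<dots> = (LINT v|distr lborel borel (\<lambda>u. y + c *\<^sub>R u). \<bar>c\<bar> ^ DIM('a) *\<^sub>R f v)"
    by (rule integral_density) auto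
  also have "\<dots> = \<bar>c\<bar> ^ DIM('a) * (LINT u|lborel. f (y + c *\<^sub>R u))"
    by (subst integral_distr) auto
  finally show ?thesis .
qed

lemma continuous_heat_kernel: "continuous_on UNIV (heat_kernel \<epsilon>)"
  unfolding heat_kernel_def divide_inverse by (intro continuous_intros)

text \<open>
  The substitution \<open>v = y + \<epsilon> u\<close> moves the dependence on \<open>\<epsilon>\<close> from the kernel into the argument of \<open>\<phi>\<close>,
  which is the form suited to limits and to bounds uniform in \<open>\<epsilon>\<close>.
\<close>

lemma heat_kernel_smoothing:
  fixes \<phi> :: "'a::euclidean_space \<Rightarrow> real"
  assumes "\<epsilon> > 0" "continuous_on UNIV \<phi>"
  shows "(LINT v|lborel. \<phi> v * heat_kernel \<epsilon> (y - v))
       = (LINT u|lborel. \<phi> (y + \<epsilon> *\<^sub>R u) * exp (- (norm u)\<^sup>2 / 2)) / sqrt (2 * pi) ^ DIM('a)"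
proof -
  let ?f = "\<lambda>v. \<phi> v * heat_kernel \<epsilon> (y - v)"
  have "continuous_on UNIV ?f"
    by (intro continuous_intros assms continuous_on_compose2[OF continuous_heat_kernel]) auto
  then have "?f \<in> borel_measurable borel" by (rule borel_measurable_continuous_onI)
  then have "(LINT v|lborel. ?f v) = \<bar>\<epsilon>\<bar> ^ DIM('a) * (LINT u|lborel. ?f (y + \<epsilon> *\<^sub>R u))"
    using assms(1) by (intro integral_lborel_affine_euclidean) auto
  also have "(\<lambda>u. ?f (y + \<epsilon> *\<^sub>R u)) = (\<lambda>u. \<phi> (y + \<epsilon> *\<^sub>R u) * exp (- (norm u)\<^sup>2 / 2) / (sqrt (2 * pi) * \<epsilon>) ^ DIM('a))"
    using assms(1) by (simp add: heat_kernel_def power_mult_distrib)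
  finally show ?thesis using assms(1) by (simp add: power_mult_distrib)
qed

text \<open>
  Convolving with a narrow heat kernel destroys compact support, but leaves a Gaussian tail whose
  width does not depend on \<open>\<epsilon> \<le> 1\<close>. This is the majorant that justifies the interchange of sum and
  integral and the limit \<open>\<epsilon> \<rightarrow> 0\<close> in the Poisson summation formula: if \<open>y + \<epsilon> u\<close> lies in the support,
  then \<open>norm y \<le> r + norm u\<close>, so half of the Gaussian in \<open>u\<close> pays for a Gaussian in \<open>y\<close>.
\<close>

lemma heat_kernel_smoothing_bound:
  fixes \<phi> :: "'a::euclidean_space \<Rightarrow> real"
  assumes "continuous_on UNIV \<phi>" "\<And>x. 0 \<le> \<phi> x" "\<And>x. \<phi> x \<le> 1" "\<And>x. \<phi> x \<noteq> 0 \<Longrightarrow> norm x \<le> r"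
  shows "\<exists>M\<ge>0. \<forall>\<epsilon> y. 0 < \<epsilon> \<longrightarrow> \<epsilon> \<le> 1 \<longrightarrow>
     (LINT v|lborel. \<phi> v * heat_kernel \<epsilon> (y - v)) \<le> M * exp (- (norm y)\<^sup>2 / 8)"
proof -
  \<comment> \<open>The constants come from \<open>(norm y)\<^sup>2 \<le> 2 r\<^sup>2 + 2 (norm u)\<^sup>2\<close>, divided by \<open>8\<close>.\<close>
  define M where "M = exp (r\<^sup>2 / 4) * (LINT u|lborel. exp (- (1 / 4) * (norm (u::'a))\<^sup>2)) / sqrt (2 * pi) ^ DIM('a)"
  have "M \<ge> 0" unfolding M_def by simp
  moreover have "(LINT v|lborel. \<phi> v * heat_kernel \<epsilon> (y - v)) \<le> M * exp (- (norm y)\<^sup>2 / 8)"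
    if e: "0 < \<epsilon>" "\<epsilon> \<le> 1" for \<epsilon> y
  proof -
    have le: "\<phi> (y + \<epsilon> *\<^sub>R u) * exp (- (norm u)\<^sup>2 / 2) \<le> exp (r\<^sup>2 / 4) * exp (- (norm y)\<^sup>2 / 8) * exp (- (1 / 4) * (norm u)\<^sup>2)" for u
    proof (cases "\<phi> (y + \<epsilon> *\<^sub>R u) = 0")
      case False
      have "norm y \<le> norm (y + \<epsilon> *\<^sub>R u) + norm (\<epsilon> *\<^sub>R u)"
        using norm_triangle_ineq4[of "y + \<epsilon> *\<^sub>R u" "\<epsilon> *\<^sub>R u"] by simp
      also have "\<dots> \<le> r + norm u"
        using assms(4)[OF False] e mult_right_mono[OF e(2), of "norm u"] by simp
      finally have "(norm y)\<^sup>2 \<le> (r + norm u)\<^sup>2" by (intro power_mono) auto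
      also have "\<dots> \<le> 2 * r\<^sup>2 + 2 * (norm u)\<^sup>2"
        using zero_le_power2[of "r - norm u"] by (simp add: power2_eq_square algebra_simps)
      finally have "- (norm u)\<^sup>2 / 2 \<le> r\<^sup>2 / 4 + - (norm y)\<^sup>2 / 8 + - (1 / 4) * (norm u)\<^sup>2" by simp
      then have "exp (- (norm u)\<^sup>2 / 2) \<le> exp (r\<^sup>2 / 4) * exp (- (norm y)\<^sup>2 / 8) * exp (- (1 / 4) * (norm u)\<^sup>2)"
        by (simp add: mult_exp_exp)
      moreover have "\<phi> (y + \<epsilon> *\<^sub>R u) * exp (- (norm u)\<^sup>2 / 2) \<le> 1 * exp (- (norm u)\<^sup>2 / 2)"
        using assms(3) by (intro mult_right_mono) auto
      ultimately show ?thesis by linarith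
    qed simp
    have "(LINT u|lborel. \<phi> (y + \<epsilon> *\<^sub>R u) * exp (- (norm u)\<^sup>2 / 2))
       \<le> (LINT (u::'a)|lborel. exp (r\<^sup>2 / 4) * exp (- (norm y)\<^sup>2 / 8) * exp (- (1 / 4) * (norm u)\<^sup>2))"
      by (rule integral_mono_AE') (use le assms(2) integrable_gaussian[of "1/4", where 'a='a] in \<open>auto intro!: AE_I2\<close>)
    then have "(LINT u|lborel. \<phi> (y + \<epsilon> *\<^sub>R u) * exp (- (norm u)\<^sup>2 / 2)) / sqrt (2 * pi) ^ DIM('a)
       \<le> (LINT (u::'a)|lborel. exp (r\<^sup>2 / 4) * exp (- (norm y)\<^sup>2 / 8) * exp (- (1 / 4) * (norm u)\<^sup>2)) / sqrt (2 * pi) ^ DIM('a)"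
      by (intro divide_right_mono) auto
    then show ?thesis
      unfolding heat_kernel_smoothing[OF e(1) assms(1)] M_def by (simp add: mult.commute mult.left_commute)
  qed
  ultimately show ?thesis by blast
qed

lemma heat_kernel_smoothing_tendsto:
  fixes \<phi> :: "'a::euclidean_space \<Rightarrow> real"
  assumes "continuous_on UNIV \<phi>" "\<And>x. 0 \<le> \<phi> x" "\<And>x. \<phi> x \<le> 1"
    and "\<And>n. \<epsilon> n > 0" "\<epsilon> \<longlonglongrightarrow> 0"
  shows "(\<lambda>n. LINT v|lborel. \<phi> v * heat_kernel (\<epsilon> n) (y - v)) \<longlonglongrightarrow> \<phi> y"
proof -
  have [measurable]: "\<phi> \<in> borel_measurable borel"
    using assms(1) by (rule borel_measurable_continuous_onI)
  have int: "integrable lborel (\<lambda>u::'a. exp (- (norm u)\<^sup>2 / 2))"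
    using integrable_gaussian[of "1/2", where 'a='a] by simp
  have "(\<lambda>n. LINT u|lborel. \<phi> (y + \<epsilon> n *\<^sub>R u) * exp (- (norm u)\<^sup>2 / 2)) \<longlonglongrightarrow> (LINT (u::'a)|lborel. \<phi> y * exp (- (norm u)\<^sup>2 / 2))"
  proof (rule integral_dominated_convergence[where w = "\<lambda>u. exp (- (norm (u::'a))\<^sup>2 / 2)", OF _ _ int])
    show "AE u in lborel. (\<lambda>n. \<phi> (y + \<epsilon> n *\<^sub>R u) * exp (- (norm u)\<^sup>2 / 2)) \<longlonglongrightarrow> \<phi> y * exp (- (norm u)\<^sup>2 / 2)"
    proof (rule AE_I2)
      fix u :: 'a
      have "(\<lambda>n. y + \<epsilon> n *\<^sub>R u) \<longlonglongrightarrow> y + 0 *\<^sub>R u" by (intro tendsto_intros assms(5))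
      moreover have "isCont \<phi> y" using assms(1) by (simp add: continuous_on_eq_continuous_at)
      ultimately have "(\<lambda>n. \<phi> (y + \<epsilon> n *\<^sub>R u)) \<longlonglongrightarrow> \<phi> y" by (intro isCont_tendsto_compose[of y \<phi>]) auto
      then show "(\<lambda>n. \<phi> (y + \<epsilon> n *\<^sub>R u) * exp (- (norm u)\<^sup>2 / 2)) \<longlonglongrightarrow> \<phi> y * exp (- (norm u)\<^sup>2 / 2)"
        by (intro tendsto_intros)
    qed
    show "AE u in lborel. norm (\<phi> (y + \<epsilon> n *\<^sub>R u) * exp (- (norm u)\<^sup>2 / 2)) \<le> exp (- (norm u)\<^sup>2 / 2)" for n
      using assms(2,3) by (intro AE_I2) (simp add: abs_mult mult_le_cancel_right1)
  qed measurable
  then have "(\<lambda>n. (LINT u|lborel. \<phi> (y + \<epsilon> n *\<^sub>R u) * exp (- (norm u)\<^sup>2 / 2)) / sqrt (2 * pi) ^ DIM('a))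
      \<longlonglongrightarrow> (LINT (u::'a)|lborel. \<phi> y * exp (- (norm u)\<^sup>2 / 2)) / sqrt (2 * pi) ^ DIM('a)"
    by (rule tendsto_divide[OF _ tendsto_const]) simp
  moreover have "(LINT (u::'a)|lborel. \<phi> y * exp (- (norm u)\<^sup>2 / 2)) / sqrt (2 * pi) ^ DIM('a) = \<phi> y"
    unfolding integral_mult_right_zero integral_standard_gaussian by simp
  ultimately show ?thesis
    unfolding heat_kernel_smoothing[OF assms(4,1)] by simp
qed

section \<open>Poisson summation for a Fourier quasicrystal\<close>

text \<open>
  Pair \<open>\<mu>\<close> and its Fourier transform with one Gaussian wave: its Fourier transform is the heat kernel
  around \<open>x\<close>, so both sums equal the same number.
\<close>

lemma heat_kernel_Poisson_summation:
  fixes \<mu> :: "'a::euclidean_space distribution"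
  assumes \<mu>: "slowly_increasing_atomic \<mu> \<Lambda> a"
    and \<mu>_hat: "slowly_increasing_atomic (fourier_distribution \<mu>) \<Gamma> b"
    and "\<epsilon> > 0"
  defines "S x \<equiv> fourier_distribution \<mu> (gaussian_wave (2 * pi\<^sup>2 * \<epsilon>\<^sup>2) 0 ((2 * pi) *\<^sub>R x))"
  shows "((\<lambda>z. a z * of_real (heat_kernel \<epsilon> (z - x))) has_sum S x) \<Lambda>"
    and "((\<lambda>\<gamma>. b \<gamma> * of_real (exp (- 2 * pi\<^sup>2 * \<epsilon>\<^sup>2 * (norm \<gamma>)\<^sup>2)) * exp (\<i> * of_real (((2 * pi) *\<^sub>R x) \<bullet> \<gamma>)))
            has_sum S x) \<Gamma>"
proof -
  let ?f = "gaussian_wave (2 * pi\<^sup>2 * \<epsilon>\<^sup>2) 0 ((2 * pi) *\<^sub>R x)"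
  have f: "?f \<in> schwartz"
    using polynomial_times_gaussian_wave_schwartz[OF polynomial_functions.const[of 1], of "2 * pi\<^sup>2 * \<epsilon>\<^sup>2"]
      assms(3) by simp
  have "fourier ?f = (\<lambda>y. of_real (1 / (sqrt (2 * pi) * \<epsilon>) ^ DIM('a)) * gaussian_wave (1 / (2 * \<epsilon>\<^sup>2)) x 0 y)"
    by (simp add: fun_eq_iff fourier_gaussian_wave[OF assms(3)] heat_kernel_def gaussian_wave_def
          power2_norm_eq_inner flip: exp_of_real)
  moreover have "\<dots> \<in> schwartz"
    by (rule polynomial_times_gaussian_wave_schwartz[OF polynomial_functions.const]) (use assms(3) in simp)
  ultimately have "fourier ?f \<in> schwartz" by (simp only:)
  then have "((\<lambda>z. a z * dirac z (fourier ?f)) has_sum \<mu> (fourier ?f)) \<Lambda>"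
    using \<mu> unfolding slowly_increasing_atomic_def by blast
  then show "((\<lambda>z. a z * of_real (heat_kernel \<epsilon> (z - x))) has_sum S x) \<Lambda>"
    by (simp add: dirac_def fourier_gaussian_wave[OF assms(3)] S_def fourier_distribution_def)
  have "((\<lambda>z. b z * dirac z ?f) has_sum S x) \<Gamma>"
    unfolding S_def using \<mu>_hat f unfolding slowly_increasing_atomic_def by blast
  then show "((\<lambda>\<gamma>. b \<gamma> * of_real (exp (- 2 * pi\<^sup>2 * \<epsilon>\<^sup>2 * (norm \<gamma>)\<^sup>2)) * exp (\<i> * of_real (((2 * pi) *\<^sub>R x) \<bullet> \<gamma>)))
            has_sum S x) \<Gamma>"
    by (rule has_sum_cong[THEN iffD1, rotated])
       (simp add: dirac_def gaussian_wave_def power2_norm_eq_inner mult_exp_exp mult.assoc flip: exp_of_real)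
qed

lemma integrable_cube_bump:
  assumes "n > 0" "\<kappa> > 0"
  shows "integrable lborel (cube_bump n \<kappa> :: 'a::euclidean_space \<Rightarrow> real)"
  using integrable_norm[OF integral_cube_bump_wave(1)[OF assms, of "0::'a"]]
  by (simp add: cube_bump_bounds(1))

lemma integrable_cube_bump_heat_kernel:
  fixes y :: "'a::euclidean_space"
  assumes "n > 0" "\<kappa> > 0" "\<epsilon> > 0"
  shows "integrable lborel (\<lambda>v. cube_bump n \<kappa> v * heat_kernel \<epsilon> (y - v))"
proof (rule Bochner_Integration.integrable_bound)
  show "integrable lborel (\<lambda>v::'a. cube_bump n \<kappa> v * heat_kernel \<epsilon> (0::'a))"
    by (intro integrable_mult_left integrable_cube_bump assms)
  have "continuous_on UNIV (\<lambda>v. cube_bump n \<kappa> v * heat_kernel \<epsilon> (y - v))"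
    by (intro continuous_intros continuous_cube_bump continuous_on_compose2[OF continuous_heat_kernel]) auto
  then show "(\<lambda>v. cube_bump n \<kappa> v * heat_kernel \<epsilon> (y - v)) \<in> borel_measurable lborel"
    using borel_measurable_continuous_onI by simp
  have "heat_kernel \<epsilon> z \<le> heat_kernel \<epsilon> (0::'a)" "0 \<le> heat_kernel \<epsilon> z" for z :: 'a
    using assms(3) by (auto simp: heat_kernel_def intro!: divide_right_mono)
  then show "AE v in lborel. norm (cube_bump n \<kappa> v * heat_kernel \<epsilon> (y - v)) \<le> norm (cube_bump n \<kappa> v * heat_kernel \<epsilon> (0::'a))"
    by (intro AE_I2) (auto simp: abs_mult cube_bump_bounds(1) intro!: mult_left_mono)
qed

text \<open>
  Integrate the formula for the heat kernel around \<open>x + v\<close> against \<open>\<phi> v\<close>. On the side of \<open>\<Lambda>\<close> the bump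
  gets convolved with the heat kernel; on the side of \<open>\<Gamma>\<close> each term is multiplied by \<open>\<Phi> \<gamma>\<close>. As the
  heat kernel shrinks, the convolution tends to the bump and the Gaussian factors on \<open>\<Gamma>\<close> tend to \<open>1\<close>.
  The assumed absolute convergence of the limit series is what permits that last step.
\<close>

lemma cube_bump_Poisson_summation:
  fixes \<mu> :: "'a::euclidean_space distribution"
  assumes \<mu>: "slowly_increasing_atomic \<mu> \<Lambda> a"
    and \<mu>_hat: "slowly_increasing_atomic (fourier_distribution \<mu>) \<Gamma> b"
    and n: "n > 0" "\<kappa> > 0"
    and sum: "(\<lambda>\<gamma>. norm (b \<gamma> * cube_bump_fourier n \<kappa> ((2 * pi) *\<^sub>R \<gamma>))) summable_on \<Gamma>"
  shows "((\<lambda>\<gamma>. b \<gamma> * cube_bump_fourier n \<kappa> ((2 * pi) *\<^sub>R \<gamma>) * exp (\<i> * of_real (((2 * pi) *\<^sub>R \<gamma>) \<bullet> x)))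
            has_sum (\<Sum>\<^sub>\<infinity>z\<in>\<Lambda>. a z * of_real (cube_bump n \<kappa> (z - x)))) \<Gamma>"
proof -
  let ?\<phi> = "cube_bump n \<kappa> :: 'a \<Rightarrow> real" and ?\<Phi> = "\<lambda>\<gamma>::'a. cube_bump_fourier n \<kappa> ((2 * pi) *\<^sub>R \<gamma>)"
  let ?e = "\<lambda>x \<gamma>::'a. exp (\<i> * of_real (((2 * pi) *\<^sub>R \<gamma>) \<bullet> x))"
  let ?G = "\<lambda>\<epsilon> \<gamma>::'a. exp (- 2 * pi\<^sup>2 * \<epsilon>\<^sup>2 * (norm \<gamma>)\<^sup>2)"
  define S where "S \<epsilon> x = fourier_distribution \<mu> (gaussian_wave (2 * pi\<^sup>2 * \<epsilon>\<^sup>2) 0 ((2 * pi) *\<^sub>R x))" for \<epsilon> x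
  define c where "c \<epsilon> y = (LINT v|lborel. ?\<phi> v * heat_kernel \<epsilon> (y - v))" for \<epsilon> y
  have countable: "countable \<Lambda>" "countable \<Gamma>" using \<mu> \<mu>_hat unfolding slowly_increasing_atomic_def by blast+
  have left: "((\<lambda>z. a z * of_real (heat_kernel \<epsilon> (z - x))) has_sum S \<epsilon> x) \<Lambda>"
    and right: "((\<lambda>\<gamma>. b \<gamma> * of_real (?G \<epsilon> \<gamma>) * ?e x \<gamma>) has_sum S \<epsilon> x) \<Gamma>" if "\<epsilon> > 0" for \<epsilon> x
    using heat_kernel_Poisson_summation[OF \<mu> \<mu>_hat that, of x] unfolding S_def by (simp_all add: inner_commute)
  have int_\<phi>: "integrable lborel ?\<phi>" by (rule integrable_cube_bump[OF n])
  have heat_nonneg: "0 \<le> heat_kernel \<epsilon> z" if "\<epsilon> > 0" for \<epsilon> and z :: 'a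
    using that by (simp add: heat_kernel_def)
  obtain M where M: "M \<ge> 0" "\<And>\<epsilon> y. 0 < \<epsilon> \<Longrightarrow> \<epsilon> \<le> 1 \<Longrightarrow> c \<epsilon> y \<le> M * exp (- (norm y)\<^sup>2 / 8)"
    using heat_kernel_smoothing_bound[OF continuous_cube_bump cube_bump_bounds cube_bump_support[OF n]]
    unfolding c_def by blast
  have c_nonneg: "0 \<le> c \<epsilon> y" if "\<epsilon> > 0" for \<epsilon> y
    unfolding c_def
    by (intro Bochner_Integration.integral_nonneg) (simp add: heat_nonneg[OF that] cube_bump_bounds(1))
  \<comment> \<open>Up to a constant, the heat kernel of width \<open>2\<close> is the Gaussian of the majorant, so its
      Poisson sum provides the summability.\<close>
  have dominant: "(\<lambda>z. norm (a z) * (M * exp (- (norm (z - x))\<^sup>2 / 8))) summable_on \<Lambda>"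
  proof -
    have "(\<lambda>z. norm (a z * of_real (heat_kernel 2 (z - x)))) summable_on \<Lambda>"
      using iffD1[OF summable_on_iff_abs_summable_on_complex has_sum_imp_summable[OF left[of 2 x]]] by simp
    then have *: "(\<lambda>z. (M * (sqrt (2 * pi) * 2) ^ DIM('a)) * norm (a z * of_real (heat_kernel 2 (z - x)))) summable_on \<Lambda>"
      by (rule summable_on_cmult_right)
    have eq: "norm (a z * of_real (heat_kernel 2 (z - x))) = norm (a z) * heat_kernel 2 (z - x)" for z
      by (simp add: norm_mult heat_nonneg)
    show ?thesis
      using *[unfolded eq] by (rule summable_on_cong[THEN iffD1, rotated]) (simp add: heat_kernel_def)
  qed
  have smoothed_left: "((\<lambda>z. a z * of_real (c \<epsilon> (z - x))) has_sum (LINT v|lborel. of_real (?\<phi> v) * S \<epsilon> (x + v))) \<Lambda>"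
    if \<epsilon>: "0 < \<epsilon>" "\<epsilon> \<le> 1" for \<epsilon>
  proof -
    let ?F = "\<lambda>z v. of_real (?\<phi> v) * (a z * of_real (heat_kernel \<epsilon> (z - (x + v)))) :: complex"
    have F: "?F z v = a z * of_real (?\<phi> v * heat_kernel \<epsilon> (z - x - v))" for z v
      by (simp add: diff_diff_eq)
    have i: "integrable lborel (\<lambda>v. ?\<phi> v * heat_kernel \<epsilon> (z - x - v))" for z
      by (rule integrable_cube_bump_heat_kernel[OF n \<epsilon>(1)])
    have "((\<lambda>z. LINT v|lborel. ?F z v) has_sum (LINT v|lborel. of_real (?\<phi> v) * S \<epsilon> (x + v))) \<Lambda>"
    proof (rule has_sum_integral[OF countable(1)])
      show "integrable lborel (?F z)" for z
        unfolding F by (intro integrable_mult_right integrable_of_real i)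
      have "(LINT v|lborel. norm (?F z v)) = norm (a z) * c \<epsilon> (z - x)" for z
        unfolding F c_def by (simp add: norm_mult abs_mult heat_nonneg[OF \<epsilon>(1)] cube_bump_bounds(1))
      moreover have "(\<lambda>z. norm (a z) * c \<epsilon> (z - x)) summable_on \<Lambda>"
        by (rule summable_on_comparison_test[OF dominant])
           (use M(2)[OF \<epsilon>] c_nonneg[OF \<epsilon>(1)] in \<open>auto intro!: mult_left_mono\<close>)
      ultimately show "(\<lambda>z. LINT v|lborel. norm (?F z v)) summable_on \<Lambda>" by simp
      show "((\<lambda>z. ?F z v) has_sum of_real (?\<phi> v) * S \<epsilon> (x + v)) \<Lambda>" for v
        by (intro has_sum_cmult_right left \<epsilon>)
    qed
    moreover have "(LINT v|lborel. ?F z v) = a z * of_real (c \<epsilon> (z - x))" for z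
      unfolding F c_def by (simp flip: integral_complex_of_real)
    ultimately show ?thesis by simp
  qed
  have smoothed_right: "((\<lambda>\<gamma>. b \<gamma> * ?\<Phi> \<gamma> * ?e x \<gamma> * of_real (?G \<epsilon> \<gamma>)) has_sum (LINT v|lborel. of_real (?\<phi> v) * S \<epsilon> (x + v))) \<Gamma>"
    if \<epsilon>: "0 < \<epsilon>" for \<epsilon>
  proof -
    let ?F = "\<lambda>\<gamma> v. of_real (?\<phi> v) * (b \<gamma> * of_real (?G \<epsilon> \<gamma>) * ?e (x + v) \<gamma>) :: complex"
    have F: "?F \<gamma> v = (b \<gamma> * of_real (?G \<epsilon> \<gamma>) * ?e x \<gamma>) * (of_real (?\<phi> v) * ?e v \<gamma>)" for \<gamma> v
      by (simp add: inner_add_right exp_add algebra_simps)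
    have "((\<lambda>\<gamma>. LINT v|lborel. ?F \<gamma> v) has_sum (LINT v|lborel. of_real (?\<phi> v) * S \<epsilon> (x + v))) \<Gamma>"
    proof (rule has_sum_integral[OF countable(2)])
      show "integrable lborel (?F \<gamma>)" for \<gamma>
        unfolding F by (intro integrable_mult_right integral_cube_bump_wave n)
      have "(LINT v|lborel. norm (?F \<gamma> v)) = norm (b \<gamma> * of_real (?G \<epsilon> \<gamma>) * ?e 0 \<gamma>) * (LINT v|lborel. ?\<phi> v)" for \<gamma>
        unfolding F by (simp add: norm_mult cube_bump_bounds(1))
      moreover have "(\<lambda>\<gamma>. norm (b \<gamma> * of_real (?G \<epsilon> \<gamma>) * ?e 0 \<gamma>)) summable_on \<Gamma>"
        by (rule iffD1[OF summable_on_iff_abs_summable_on_complex has_sum_imp_summable[OF right[OF \<epsilon>]]])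
      ultimately show "(\<lambda>\<gamma>. LINT v|lborel. norm (?F \<gamma> v)) summable_on \<Gamma>"
        by (simp only: summable_on_cmult_left)
      show "((\<lambda>\<gamma>. ?F \<gamma> v) has_sum of_real (?\<phi> v) * S \<epsilon> (x + v)) \<Gamma>" for v
        by (intro has_sum_cmult_right right \<epsilon>)
    qed
    moreover have "(LINT v|lborel. ?F \<gamma> v) = b \<gamma> * ?\<Phi> \<gamma> * ?e x \<gamma> * of_real (?G \<epsilon> \<gamma>)" for \<gamma>
      unfolding F integral_mult_right_zero integral_cube_bump_wave(2)[OF n] by (simp only: mult_ac)
    ultimately show ?thesis by simp
  qed
  define \<epsilon> where "\<epsilon> k = inverse (real (Suc k))" for k
  have \<epsilon>: "0 < \<epsilon> k" "\<epsilon> k \<le> 1" for k by (simp_all add: \<epsilon>_def field_simps)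
  have \<epsilon>_lim: "\<epsilon> \<longlonglongrightarrow> 0" unfolding \<epsilon>_def by (rule LIMSEQ_inverse_real_of_nat)
  let ?I = "\<lambda>k. LINT v|lborel. of_real (?\<phi> v) * S (\<epsilon> k) (x + v)"
  have "?I \<longlonglongrightarrow> (\<Sum>\<^sub>\<infinity>z\<in>\<Lambda>. a z * of_real (?\<phi> (z - x)))"
  proof (rule has_sum_dominated_convergence(2)[OF _ _ dominant smoothed_left[OF \<epsilon>]])
    show "(\<lambda>k. a z * of_real (c (\<epsilon> k) (z - x))) \<longlonglongrightarrow> a z * of_real (?\<phi> (z - x))" for z
      unfolding c_def
      by (intro tendsto_intros tendsto_of_real heat_kernel_smoothing_tendsto continuous_cube_bump cube_bump_bounds \<epsilon> \<epsilon>_lim)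
    show "norm (a z * of_real (c (\<epsilon> k) (z - x))) \<le> norm (a z) * (M * exp (- (norm (z - x))\<^sup>2 / 8))" for k z
      using M(2)[OF \<epsilon>] c_nonneg[OF \<epsilon>(1)] by (simp add: norm_mult mult_left_mono)
  qed
  moreover have "?I \<longlonglongrightarrow> (\<Sum>\<^sub>\<infinity>\<gamma>\<in>\<Gamma>. b \<gamma> * ?\<Phi> \<gamma> * ?e x \<gamma>)" and "(\<lambda>\<gamma>. b \<gamma> * ?\<Phi> \<gamma> * ?e x \<gamma>) summable_on \<Gamma>"
  proof -
    have lim: "(\<lambda>k. b \<gamma> * ?\<Phi> \<gamma> * ?e x \<gamma> * of_real (?G (\<epsilon> k) \<gamma>)) \<longlonglongrightarrow> b \<gamma> * ?\<Phi> \<gamma> * ?e x \<gamma>" for \<gamma>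
    proof -
      have "(\<lambda>k. b \<gamma> * ?\<Phi> \<gamma> * ?e x \<gamma> * of_real (?G (\<epsilon> k) \<gamma>)) \<longlonglongrightarrow> b \<gamma> * ?\<Phi> \<gamma> * ?e x \<gamma> * of_real (?G 0 \<gamma>)"
        by (intro tendsto_intros \<epsilon>_lim)
      then show ?thesis by simp
    qed
    have bound: "norm (b \<gamma> * ?\<Phi> \<gamma> * ?e x \<gamma> * of_real (?G (\<epsilon> k) \<gamma>)) \<le> norm (b \<gamma> * ?\<Phi> \<gamma>)" for k \<gamma>
      by (simp add: norm_mult mult_left_le)
    show "?I \<longlonglongrightarrow> (\<Sum>\<^sub>\<infinity>\<gamma>\<in>\<Gamma>. b \<gamma> * ?\<Phi> \<gamma> * ?e x \<gamma>)" "(\<lambda>\<gamma>. b \<gamma> * ?\<Phi> \<gamma> * ?e x \<gamma>) summable_on \<Gamma>"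
      using has_sum_dominated_convergence[OF lim bound sum smoothed_right[OF \<epsilon>(1)]] by blast+
  qed
  ultimately show ?thesis
    by (metis (no_types, lifting) LIMSEQ_unique has_sum_infsum)
qed

section \<open>Bochner almost periodic functions\<close>

text \<open>
  The translates of \<open>f\<close> form a totally bounded set in the uniform norm: finitely many sets of shifts
  cover the space, and shifts in the same set give uniformly \<open>\<epsilon>\<close>-close translates. Differences
  \<open>x - y\<close> of shifts in one set are then \<open>\<epsilon>\<close>-almost periods. This form passes to several functions at
  once by intersecting covers.
\<close>

definition bochner_almost_periodic :: "('a::real_normed_vector \<Rightarrow> complex) \<Rightarrow> bool" where
  "bochner_almost_periodic f \<longleftrightarrow>
     (\<forall>\<epsilon>>0. \<exists>\<C>. finite \<C> \<and> \<Union>\<C> = UNIV \<and>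
        (\<forall>C\<in>\<C>. \<forall>x\<in>C. \<forall>y\<in>C. \<forall>z. norm (f (z + x) - f (z + y)) \<le> \<epsilon>))"

lemma bochner_almost_periodicE:
  assumes "bochner_almost_periodic f" "\<epsilon> > 0"
  obtains \<C> where "finite \<C>" "\<Union>\<C> = UNIV"
    "\<forall>C\<in>\<C>. \<forall>x\<in>C. \<forall>y\<in>C. \<forall>z. norm (f (z + x) - f (z + y)) \<le> \<epsilon>"
proof -
  from assms have "\<exists>\<C>. finite \<C> \<and> \<Union>\<C> = UNIV \<and>
        (\<forall>C\<in>\<C>. \<forall>x\<in>C. \<forall>y\<in>C. \<forall>z. norm (f (z + x) - f (z + y)) \<le> \<epsilon>)"
    unfolding bochner_almost_periodic_def by simp
  then obtain \<C> where "finite \<C> \<and> \<Union>\<C> = UNIV \<and>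
        (\<forall>C\<in>\<C>. \<forall>x\<in>C. \<forall>y\<in>C. \<forall>z. norm (f (z + x) - f (z + y)) \<le> \<epsilon>)" ..
  then show thesis by (intro that[of \<C>]) simp_all
qed

lemma bochner_almost_periodic_common_cover:
  assumes "bochner_almost_periodic f" "bochner_almost_periodic g" "\<epsilon> > 0" "\<delta> > 0"
  obtains \<C> where "finite \<C>" "\<Union>\<C> = UNIV"
    "\<forall>C\<in>\<C>. \<forall>x\<in>C. \<forall>y\<in>C. \<forall>z. norm (f (z + x) - f (z + y)) \<le> \<epsilon>"
    "\<forall>C\<in>\<C>. \<forall>x\<in>C. \<forall>y\<in>C. \<forall>z. norm (g (z + x) - g (z + y)) \<le> \<delta>"
proof -
  obtain \<A> where A: "finite \<A>" "\<Union>\<A> = UNIV"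
    "\<forall>C\<in>\<A>. \<forall>x\<in>C. \<forall>y\<in>C. \<forall>z. norm (f (z + x) - f (z + y)) \<le> \<epsilon>"
    by (rule bochner_almost_periodicE[OF assms(1,3)])
  obtain \<B> where B: "finite \<B>" "\<Union>\<B> = UNIV"
    "\<forall>C\<in>\<B>. \<forall>x\<in>C. \<forall>y\<in>C. \<forall>z. norm (g (z + x) - g (z + y)) \<le> \<delta>"
    by (rule bochner_almost_periodicE[OF assms(2,4)])
  let ?C = "(\<lambda>(A, B). A \<inter> B) ` (\<A> \<times> \<B>)"
  show thesis
  proof (rule that[of ?C])
    show "finite ?C" using A(1) B(1) by auto
    show "\<Union>?C = UNIV"
    proof (intro equalityI subsetI UNIV_I)
      fix x
      obtain P Q where "P \<in> \<A>" "x \<in> P" "Q \<in> \<B>" "x \<in> Q" using A(2) B(2) by blast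
      then show "x \<in> \<Union>?C" by force
    qed
  qed (use A(3) B(3) in auto)
qed

lemma bochner_almost_periodic_add:
  assumes "bochner_almost_periodic f" "bochner_almost_periodic g"
  shows "bochner_almost_periodic (\<lambda>x. f x + g x)"
  unfolding bochner_almost_periodic_def
proof (intro allI impI)
  fix \<epsilon> :: real assume "\<epsilon> > 0"
  then have e: "\<epsilon> / 2 > 0" by simp
  obtain \<C> where C: "finite \<C>" "\<Union>\<C> = UNIV"
    "\<forall>C\<in>\<C>. \<forall>x\<in>C. \<forall>y\<in>C. \<forall>z. norm (f (z + x) - f (z + y)) \<le> \<epsilon> / 2"
    "\<forall>C\<in>\<C>. \<forall>x\<in>C. \<forall>y\<in>C. \<forall>z. norm (g (z + x) - g (z + y)) \<le> \<epsilon> / 2"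
    by (rule bochner_almost_periodic_common_cover[OF assms e e])
  have "norm (f (z + x) + g (z + x) - (f (z + y) + g (z + y))) \<le> \<epsilon>"
    if "C \<in> \<C>" "x \<in> C" "y \<in> C" for C x y z
    using norm_triangle_ineq[of "f (z + x) - f (z + y)" "g (z + x) - g (z + y)"]
      C(3)[rule_format, OF that, of z] C(4)[rule_format, OF that, of z] by (simp add: algebra_simps)
  with C(1,2) show "\<exists>\<C>. finite \<C> \<and> \<Union>\<C> = UNIV \<and> (\<forall>C\<in>\<C>. \<forall>x\<in>C. \<forall>y\<in>C. \<forall>z.
      norm (f (z + x) + g (z + x) - (f (z + y) + g (z + y))) \<le> \<epsilon>)" by (intro exI[of _ \<C>]) simp
qed

text \<open>
  Two translates of a character differ uniformly by \<open>norm (f x - f y)\<close>, so a finite cover of the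
  compact disc of values pulls back to a suitable cover of shifts.
\<close>

lemma bochner_almost_periodic_exponential:
  fixes w :: "'a::real_inner"
  shows "bochner_almost_periodic (\<lambda>x. c * exp (\<i> * of_real (w \<bullet> x)))" (is "bochner_almost_periodic ?f")
  unfolding bochner_almost_periodic_def
proof (intro allI impI)
  fix \<epsilon> :: real assume e: "\<epsilon> > 0"
  obtain K where K: "finite K" "cball (0::complex) (norm c) \<subseteq> (\<Union>k\<in>K. ball k (\<epsilon> / 2))"
    using compact_eq_totally_bounded[THEN iffD1, THEN conjunct2, rule_format, OF compact_cball[of "0::complex" "norm c"] half_gt_zero[OF e]]
    by blast
  let ?C = "(\<lambda>k. ?f -` ball k (\<epsilon> / 2)) ` K"
  have close: "norm (?f (z + x) - ?f (z + y)) \<le> \<epsilon>" if "dist k (?f x) < \<epsilon> / 2" "dist k (?f y) < \<epsilon> / 2" for k x y z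
  proof -
    have "?f (z + x) - ?f (z + y) = exp (\<i> * of_real (w \<bullet> z)) * (?f x - ?f y)"
      by (simp add: inner_add_right exp_add algebra_simps)
    then have "norm (?f (z + x) - ?f (z + y)) = dist (?f x) (?f y)"
      by (simp add: norm_mult dist_norm)
    also have "\<dots> \<le> \<epsilon>" using that dist_triangle_half_r[of k "?f x" \<epsilon> "?f y"] by simp
    finally show ?thesis .
  qed
  have "\<Union>?C = UNIV"
  proof (intro equalityI subsetI UNIV_I)
    fix x
    have "?f x \<in> cball 0 (norm c)" by (simp add: norm_mult)
    with K(2) show "x \<in> \<Union>?C" by blast
  qed
  moreover have "\<forall>C\<in>?C. \<forall>x\<in>C. \<forall>y\<in>C. \<forall>z. norm (?f (z + x) - ?f (z + y)) \<le> \<epsilon>"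
  proof (intro ballI allI)
    fix C x y z assume C: "C \<in> ?C" "x \<in> C" "y \<in> C"
    then obtain k where k: "C = ?f -` ball k (\<epsilon> / 2)" by (elim imageE)
    show "norm (?f (z + x) - ?f (z + y)) \<le> \<epsilon>"
      using C(2,3) by (intro close[of k]) (simp_all add: k)
  qed
  moreover have "finite ?C" using K(1) by simp
  ultimately show "\<exists>\<C>. finite \<C> \<and> \<Union>\<C> = UNIV \<and>
        (\<forall>C\<in>\<C>. \<forall>x\<in>C. \<forall>y\<in>C. \<forall>z. norm (?f (z + x) - ?f (z + y)) \<le> \<epsilon>)"
    by blast
qed

lemma bochner_almost_periodic_sum:
  assumes "finite F" "\<And>i. i \<in> F \<Longrightarrow> bochner_almost_periodic (f i)"
  shows "bochner_almost_periodic (\<lambda>x. \<Sum>i\<in>F. f i x)"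
  using assms
proof (induction F)
  case empty
  have "bochner_almost_periodic (\<lambda>x::'b. 0)"
    unfolding bochner_almost_periodic_def by (auto intro!: exI[of _ "{UNIV}"])
  then show ?case by simp
qed (auto intro: bochner_almost_periodic_add)

lemma bochner_almost_periodic_uniform_limit:
  assumes "\<And>\<epsilon>. \<epsilon> > 0 \<Longrightarrow> \<exists>g. bochner_almost_periodic g \<and> (\<forall>x. norm (f x - g x) \<le> \<epsilon>)"
  shows "bochner_almost_periodic f"
  unfolding bochner_almost_periodic_def
proof (intro allI impI)
  fix \<epsilon> :: real assume "\<epsilon> > 0"
  then have e: "\<epsilon> / 3 > 0" by simp
  then obtain g where g: "bochner_almost_periodic g" "\<And>x. norm (f x - g x) \<le> \<epsilon> / 3" using assms by blast
  obtain \<C> where C: "finite \<C>" "\<Union>\<C> = UNIV"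
    "\<forall>C\<in>\<C>. \<forall>x\<in>C. \<forall>y\<in>C. \<forall>z. norm (g (z + x) - g (z + y)) \<le> \<epsilon> / 3"
    by (rule bochner_almost_periodicE[OF g(1) e])
  have "norm (f (z + x) - f (z + y)) \<le> \<epsilon>" if "C \<in> \<C>" "x \<in> C" "y \<in> C" for C x y z
  proof -
    have "dist (f (z + x)) (f (z + y)) \<le> dist (f (z + x)) (g (z + x)) + dist (g (z + x)) (g (z + y)) + dist (f (z + y)) (g (z + y))"
      using dist_triangle[of "f (z + x)" "f (z + y)" "g (z + x)"]
        dist_triangle2[of "g (z + x)" "f (z + y)" "g (z + y)"] by linarith
    then have "norm (f (z + x) - f (z + y)) \<le> norm (f (z + x) - g (z + x)) + norm (g (z + x) - g (z + y)) + norm (f (z + y) - g (z + y))"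
      by (simp only: dist_norm)
    then show ?thesis using C(3)[rule_format, OF that, of z] g(2)[of "z + x"] g(2)[of "z + y"] by simp
  qed
  with C(1,2) show "\<exists>\<C>. finite \<C> \<and> \<Union>\<C> = UNIV \<and>
        (\<forall>C\<in>\<C>. \<forall>x\<in>C. \<forall>y\<in>C. \<forall>z. norm (f (z + x) - f (z + y)) \<le> \<epsilon>)" by (intro exI[of _ \<C>]) simp
qed

text \<open>
  Absolute convergence makes the finite partial sums converge uniformly.
\<close>

lemma bochner_almost_periodic_exponential_series:
  fixes c :: "'i \<Rightarrow> complex" and w :: "'i \<Rightarrow> 'a::real_inner"
  assumes "(\<lambda>i. norm (c i)) summable_on I"
    and f: "\<And>x. ((\<lambda>i. c i * exp (\<i> * of_real (w i \<bullet> x))) has_sum f x) I"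
  shows "bochner_almost_periodic f"
proof (rule bochner_almost_periodic_uniform_limit)
  fix \<epsilon> :: real assume e: "\<epsilon> > 0"
  let ?t = "\<lambda>x i. c i * exp (\<i> * of_real (w i \<bullet> x))"
  from assms(1) have "((\<lambda>i. norm (c i)) has_sum (\<Sum>\<^sub>\<infinity>i\<in>I. norm (c i))) I" by simp
  from has_sum_finite_approximation[OF this e]
  obtain F where F: "finite F" "F \<subseteq> I" "dist (\<Sum>i\<in>F. norm (c i)) (\<Sum>\<^sub>\<infinity>i\<in>I. norm (c i)) \<le> \<epsilon>" by blast
  have sF: "(\<lambda>i. norm (c i)) summable_on (I - F)"
    by (rule summable_on_subset_banach[OF assms(1)]) auto
  have "((\<lambda>i. norm (c i)) has_sum (\<Sum>\<^sub>\<infinity>i\<in>I. norm (c i)) - (\<Sum>i\<in>F. norm (c i))) (I - F)"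
    by (rule has_sum_Diff[OF _ has_sum_finite[OF F(1)] F(2)]) (use assms(1) in simp)
  from infsumI[OF this] have tail: "(\<Sum>\<^sub>\<infinity>i\<in>I - F. norm (c i)) \<le> \<epsilon>"
    using F(3) by (simp add: dist_real_def)
  have "norm (f x - (\<Sum>i\<in>F. ?t x i)) \<le> (\<Sum>\<^sub>\<infinity>i\<in>I - F. norm (c i))" for x
  proof (rule norm_has_sum_bound[where A = "I - F" and f = "?t x"])
    show "(?t x has_sum (f x - (\<Sum>i\<in>F. ?t x i))) (I - F)"
      by (rule has_sum_Diff[OF f has_sum_finite[OF F(1)] F(2)])
    show "((\<lambda>i. norm (?t x i)) has_sum (\<Sum>\<^sub>\<infinity>i\<in>I - F. norm (c i))) (I - F)"
      using sF by (simp add: norm_mult)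
  qed
  with tail have "norm (f x - (\<Sum>i\<in>F. ?t x i)) \<le> \<epsilon>" for x
    by (meson order_trans)
  moreover have "bochner_almost_periodic (\<lambda>x. \<Sum>i\<in>F. ?t x i)"
    by (intro bochner_almost_periodic_sum F bochner_almost_periodic_exponential)
  ultimately show "\<exists>g. bochner_almost_periodic g \<and> (\<forall>x. norm (f x - g x) \<le> \<epsilon>)"
    by (intro exI[of _ "\<lambda>x. \<Sum>i\<in>F. ?t x i"]) simp
qed

section \<open>Almost periodic sets of finite local complexity\<close>

text \<open>
  At every scale \<open>\<delta>\<close> there is an almost periodic function supported near \<open>E\<close> and bounded below, by
  a constant that does not depend on \<open>\<delta>\<close>, at the points of \<open>E\<close> that are isolated at scale \<open>\<delta>\<close>. Isolation
  is required because masses of close points may cancel.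
\<close>

definition almost_periodically_detected :: "'a::euclidean_space set \<Rightarrow> bool" where
  "almost_periodically_detected E \<longleftrightarrow> (\<exists>c>0. \<forall>\<delta>>0. \<exists>H.
     bochner_almost_periodic H \<and>
     (\<forall>x. H x \<noteq> 0 \<longrightarrow> (\<exists>u\<in>E. dist u x < \<delta>)) \<and>
     (\<forall>u\<in>E. E \<inter> ball u \<delta> = {u} \<longrightarrow> c \<le> norm (H u)))"

definition relatively_dense :: "'a::metric_space set \<Rightarrow> bool" where
  "relatively_dense E \<longleftrightarrow> (\<exists>R. \<forall>x. \<exists>u\<in>E. dist u x \<le> R)"

definition difference_set :: "'a::ab_group_add set \<Rightarrow> 'a set \<Rightarrow> 'a set" where
  "difference_set A B = {x - y | x y. x \<in> A \<and> y \<in> B}"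

lemma discrete_in_space_finite_bounded:
  fixes E :: "'a::euclidean_space set"
  assumes "discrete_in_space E" "bounded S"
  shows "finite (E \<inter> S)"
proof -
  obtain r where "S \<subseteq> ball 0 r" using bounded_subset_ballD[OF assms(2), of 0] by blast
  then have "S \<subseteq> cball 0 r" by (rule order_trans) (rule ball_subset_cball)
  moreover obtain K :: "'a set" where K: "finite K" "cball 0 r \<subseteq> (\<Union>k\<in>K. ball k 1)"
    using compact_eq_totally_bounded[THEN iffD1, THEN conjunct2, rule_format,
        OF compact_cball[of "0::'a" r] zero_less_one]
    by blast
  ultimately have "S \<subseteq> (\<Union>k\<in>K. ball k 1)" by (meson order_trans)
  then have "E \<inter> S \<subseteq> (\<Union>k\<in>K. E \<inter> ball k 1)" by blast
  moreover have "finite (\<Union>k\<in>K. E \<inter> ball k 1)"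
    using assms(1) K(1) by (intro finite_UN_I) (simp_all add: discrete_in_space_def)
  ultimately show ?thesis by (rule finite_subset)
qed

lemma discrete_in_space_isolating_radius:
  fixes E :: "'a::euclidean_space set"
  assumes "discrete_in_space E" "bounded S"
  obtains \<delta> where "\<delta> > 0" "\<And>x y. x \<in> E \<inter> S \<Longrightarrow> y \<in> E \<inter> S \<Longrightarrow> x \<noteq> y \<Longrightarrow> \<delta> \<le> dist x y"
proof -
  let ?D = "{(x, y). x \<in> E \<inter> S \<and> y \<in> E \<inter> S \<and> x \<noteq> y}"
  have "finite (E \<inter> S)" by (rule discrete_in_space_finite_bounded[OF assms])
  then have "finite ((E \<inter> S) \<times> (E \<inter> S))" by simp
  then have fin: "finite ?D" by (rule finite_subset[rotated]) auto
  show thesis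
  proof (rule that[of "Min (insert 1 ((\<lambda>(x, y). dist x y) ` ?D))"])
    show "0 < Min (insert 1 ((\<lambda>(x, y). dist x y) ` ?D))"
      using fin by (subst Min_gr_iff) auto
    fix x y assume "x \<in> E \<inter> S" "y \<in> E \<inter> S" "x \<noteq> y"
    then have "dist x y \<in> insert 1 ((\<lambda>(x, y). dist x y) ` ?D)"
      by (intro insertI2 image_eqI[of _ _ "(x, y)"]) auto
    then show "Min (insert 1 ((\<lambda>(x, y). dist x y) ` ?D)) \<le> dist x y"
      using fin by (intro Min_le) auto
  qed
qed

text \<open>
  Start from one point \<open>u\<close> and a scale at which it is isolated. Any target \<open>x\<close> differs from \<open>u\<close> by an
  almost period up to one of finitely many shifts, and the function is still nonzero after
  translation by an almost period.
\<close>

lemma detected_relatively_dense: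
  fixes E :: "'a::euclidean_space set"
  assumes "almost_periodically_detected E" "discrete_in_space E" "E \<noteq> {}"
  shows "relatively_dense E"
proof -
  obtain u where u: "u \<in> E" using assms(3) by blast
  obtain \<delta> where d: "\<delta> > 0" "\<And>x y. x \<in> E \<inter> ball u 1 \<Longrightarrow> y \<in> E \<inter> ball u 1 \<Longrightarrow> x \<noteq> y \<Longrightarrow> \<delta> \<le> dist x y"
    using discrete_in_space_isolating_radius[OF assms(2) bounded_ball[of u 1]] by blast
  let ?d = "min \<delta> 1"
  obtain c where c: "c > 0" "\<And>\<delta>. \<delta> > 0 \<Longrightarrow> \<exists>H. bochner_almost_periodic H \<and>
     (\<forall>x. H x \<noteq> 0 \<longrightarrow> (\<exists>u\<in>E. dist u x < \<delta>)) \<and> (\<forall>u\<in>E. E \<inter> ball u \<delta> = {u} \<longrightarrow> c \<le> norm (H u))"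
    using assms(1) unfolding almost_periodically_detected_def by blast
  obtain H where H: "bochner_almost_periodic H" "\<And>x. H x \<noteq> 0 \<Longrightarrow> \<exists>u\<in>E. dist u x < ?d"
     "\<And>u. u \<in> E \<Longrightarrow> E \<inter> ball u ?d = {u} \<Longrightarrow> c \<le> norm (H u)"
  proof -
    have "?d > 0" using d(1) by simp
    from c(2)[OF this] show thesis using that by blast
  qed
  have "E \<inter> ball u ?d = {u}" using u d by (force simp: dist_commute)
  then have Hu: "c \<le> norm (H u)" using H(3) u by blast
  have "c / 2 > 0" using c(1) by simp
  obtain \<C> where C: "finite \<C>" "\<Union>\<C> = UNIV"
    "\<forall>C\<in>\<C>. \<forall>x\<in>C. \<forall>y\<in>C. \<forall>z. norm (H (z + x) - H (z + y)) \<le> c / 2"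
    by (rule bochner_almost_periodicE[OF H(1) \<open>c / 2 > 0\<close>])
  define k where "k C = (SOME x. x \<in> C)" for C :: "'a set"
  have "bounded (k ` \<C>)" using C(1) by (simp add: finite_imp_bounded)
  then obtain R where R: "\<And>C. C \<in> \<C> \<Longrightarrow> norm (k C) \<le> R" unfolding bounded_iff by auto
  have "\<exists>v\<in>E. dist v x \<le> R + 1" for x
  proof -
    obtain C where C': "C \<in> \<C>" "u - x \<in> C" using C(2) by blast
    then have "k C \<in> C" unfolding k_def by (metis someI)
    from C(3)[rule_format, OF C'(1,2) this, of x] have "norm (H u - H (x + k C)) \<le> c / 2" by simp
    with Hu c(1) have "H (x + k C) \<noteq> 0" by auto
    then obtain v where v: "v \<in> E" "dist v (x + k C) < ?d" using H(2) by blast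
    moreover have "dist v x \<le> dist v (x + k C) + norm (k C)"
      using dist_triangle[of v x "x + k C"] by (simp add: dist_norm)
    ultimately show ?thesis using R[OF C'(1)] by force
  qed
  then show ?thesis unfolding relatively_dense_def by blast
qed

text \<open>
  Write \<open>a - a' = (a - b) - (a' - b)\<close> with \<open>b \<in> B\<close> close to \<open>a'\<close>: both terms on the right range over
  finite sets while \<open>a - a'\<close> stays bounded.
\<close>

lemma discrete_differences_via_relatively_dense:
  fixes A A' B :: "'a::euclidean_space set"
  assumes "discrete_in_space (difference_set A B)" "discrete_in_space (difference_set A' B)"
    and "relatively_dense B"
  shows "discrete_in_space (difference_set A A')"
  unfolding discrete_in_space_def
proof
  fix x :: 'a
  obtain R where R: "\<And>x. \<exists>u\<in>B. dist u x \<le> R" using assms(3) unfolding relatively_dense_def by blast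
  let ?P = "difference_set A B \<inter> cball 0 (R + norm x + 1)" and ?Q = "difference_set A' B \<inter> cball 0 R"
  have "difference_set A A' \<inter> ball x 1 \<subseteq> (\<lambda>(p, q). p - q) ` (?P \<times> ?Q)"
  proof
    fix d assume "d \<in> difference_set A A' \<inter> ball x 1"
    then obtain a a' where a: "a \<in> A" "a' \<in> A'" "d = a - a'" "dist x (a - a') < 1"
      unfolding difference_set_def by auto
    obtain b where b: "b \<in> B" "dist b a' \<le> R" using R by blast
    have 1: "norm (a' - b) \<le> R" using b(2) by (simp add: dist_norm norm_minus_commute)
    have "norm (a - a') \<le> norm x + 1"
      using a(4) norm_triangle_ineq2[of "a - a'" x] by (simp add: dist_norm norm_minus_commute)
    then have "norm (a - b) \<le> R + norm x + 1"
      using 1 norm_triangle_ineq[of "a - a'" "a' - b"] by simp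
    with 1 a b have "(a - b, a' - b) \<in> ?P \<times> ?Q"
      by (auto simp: difference_set_def)
    moreover have "d = (\<lambda>(p, q). p - q) (a - b, a' - b)" using a by simp
    ultimately show "d \<in> (\<lambda>(p, q). p - q) ` (?P \<times> ?Q)" by blast
  qed
  moreover have "finite ?P" "finite ?Q"
    by (auto intro: discrete_in_space_finite_bounded assms)
  ultimately show "finite (difference_set A A' \<inter> ball x 1)"
    by (meson finite_SigmaI finite_imageI finite_subset)
qed

text \<open>
  If each point of \<open>U\<close> has a counterpart near its translate by \<open>\<tau>\<close>, then all the displacements agree.
  For neighbouring points, the difference of the counterparts is close to the original difference,
  and two differences of bounded length that are \<open>2 \<delta>\<close>-close coincide; so the displacement is the
  same. Relative density links all points of \<open>U\<close> into one chain of neighbours.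
\<close>

lemma rigid_displacement:
  fixes U :: "'a::euclidean_space set"
  assumes dense: "\<And>x. \<exists>u\<in>U. dist u x \<le> R"
    and sep: "\<And>d e. d \<in> difference_set U U \<Longrightarrow> e \<in> difference_set U U \<Longrightarrow> norm d \<le> 2 * R + 2 \<Longrightarrow>
                norm e \<le> 2 * R + 2 \<Longrightarrow> dist d e < 2 * \<delta> \<Longrightarrow> d = e"
    and \<delta>: "\<delta> \<le> 1 / 2"
    and move: "\<And>u. u \<in> U \<Longrightarrow> \<exists>v\<in>U. norm (v - u - \<tau>) < \<delta>"
  shows "\<exists>\<sigma>. norm (\<sigma> - \<tau>) < \<delta> \<and> (\<forall>u\<in>U. \<forall>v\<in>U. norm (v - u - \<tau>) < \<delta> \<longrightarrow> v = u + \<sigma>)"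
proof -
  have rigid: "v - u = v' - u'"
    if "u \<in> U" "v \<in> U" "u' \<in> U" "v' \<in> U" "norm (v - u - \<tau>) < \<delta>" "norm (v' - u' - \<tau>) < \<delta>" "dist u u' \<le> 2 * R + 1"
    for u v u' v'
  proof -
    have "norm ((v - u - \<tau>) - (v' - u' - \<tau>)) < 2 * \<delta>"
      using that(5,6) norm_triangle_ineq4[of "v - u - \<tau>" "v' - u' - \<tau>"] by linarith
    moreover have "(v - v') - (u - u') = (v - u - \<tau>) - (v' - u' - \<tau>)" by simp
    ultimately have *: "norm ((v - v') - (u - u')) < 2 * \<delta>" by (simp only:)
    have "norm (u - u') \<le> 2 * R + 1" using that(7) by (simp add: dist_norm)
    then have "norm (v - v') \<le> 2 * R + 2"
      using * \<delta> norm_triangle_ineq2[of "v - v'" "u - u'"] by linarith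
    have "v - v' = u - u'"
      by (rule sep) (use that * \<open>norm (v - v') \<le> _\<close> \<open>norm (u - u') \<le> _\<close> in \<open>auto simp: difference_set_def dist_norm\<close>)
    then show ?thesis by (simp add: algebra_simps)
  qed
  obtain s where s: "\<And>u. u \<in> U \<Longrightarrow> s u \<in> U \<and> norm (s u - u - \<tau>) < \<delta>" using move by metis
  obtain n where n: "\<And>x. n x \<in> U \<and> dist (n x) x \<le> R" using dense by metis
  have R: "R \<ge> 0" using n zero_le_dist by (meson order_trans)
  \<comment> \<open>The displacement, read off at a nearby point of \<open>U\<close>, becomes a locally constant function on
      the whole connected space.\<close>
  define g where "g x = s (n x) - n x" for x
  have "g x = g 0" for x
  proof (rule connected_local_const[where A = UNIV and f = g])
    show "\<forall>x\<in>UNIV. \<forall>\<^sub>F y in at x within UNIV. g x = g y"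
    proof
      fix x :: 'a
      have "\<forall>\<^sub>F y in at x. dist y x < 1" by (metis dist_commute_lessI eventually_at zero_less_one)
      then show "\<forall>\<^sub>F y in at x within UNIV. g x = g y"
      proof (rule eventually_mono)
        fix y assume "dist y x < 1"
        then have "dist (n x) (n y) \<le> 2 * R + 1"
          using n[of x] n[of y] dist_triangle[of "n x" "n y" x] dist_triangle[of x "n y" y]
          by (simp add: dist_commute)
        then show "g x = g y" unfolding g_def using rigid s n by blast
      qed
    qed
  qed auto
  then have g: "g x = g y" for x y by metis
  have "v = u + g 0" if "u \<in> U" "v \<in> U" "norm (v - u - \<tau>) < \<delta>" for u v
  proof -
    have "dist u (n u) \<le> 2 * R + 1" using n[of u] R by (simp add: dist_commute)
    then have "v - u = g u" unfolding g_def using rigid that s n by blast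
    with g[of u 0] show ?thesis by (simp add: algebra_simps)
  qed
  moreover have "norm (g 0 - \<tau>) < \<delta>" using s n unfolding g_def by blast
  ultimately show ?thesis by blast
qed

text \<open>
  Almost periods \<open>x - y\<close> arise from two shifts in one member of a common finite cover, and
  \<open>rigid_displacement\<close> corrects each to an exact displacement \<open>\<sigma>\<close> with \<open>A + \<sigma> \<subseteq> A\<close> and \<open>B + \<sigma> \<subseteq> B\<close>. The same
  applies to \<open>y - x\<close>, and the two displacements must cancel, so \<open>\<sigma>\<close> is a period. Choosing one shift in
  each member of the cover shows that every \<open>x\<close> lies at bounded distance from a period.
\<close>

lemma common_exact_periods:
  fixes A B :: "'a::euclidean_space set"
  assumes "almost_periodically_detected A" "almost_periodically_detected B"
    and dA: "relatively_dense A"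
    and disc: "discrete_in_space (difference_set (A \<union> B) (A \<union> B))"
  shows "relatively_dense {\<sigma>. (+) \<sigma> ` A = A \<and> (+) \<sigma> ` B = B}"
proof -
  let ?U = "A \<union> B" and ?G = "{\<sigma>. (+) \<sigma> ` A = A \<and> (+) \<sigma> ` B = B}"
  obtain R where R: "\<And>x. \<exists>u\<in>A. dist u x \<le> R" using dA unfolding relatively_dense_def by blast
  then have R0: "R \<ge> 0" using zero_le_dist by (meson order_trans)
  have "bounded (cball (0::'a) (2 * R + 2))" by simp
  from discrete_in_space_isolating_radius[OF disc this]
  obtain \<delta>' where d': "\<delta>' > 0" and
    sep': "\<And>d e. d \<in> difference_set ?U ?U \<inter> cball 0 (2*R+2) \<Longrightarrow> e \<in> difference_set ?U ?U \<inter> cball 0 (2*R+2)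
       \<Longrightarrow> d \<noteq> e \<Longrightarrow> \<delta>' \<le> dist d e" by blast
  define \<delta> where "\<delta> = min (\<delta>' / 2) (1 / 2)"
  have \<delta>: "\<delta> > 0" "\<delta> \<le> 1 / 2" "2 * \<delta> \<le> \<delta>'" using d' by (auto simp: \<delta>_def)
  have sep: "d = e" if "d \<in> difference_set ?U ?U" "e \<in> difference_set ?U ?U" "norm d \<le> 2 * R + 2"
                "norm e \<le> 2 * R + 2" "dist d e < 2 * \<delta>" for d e
    using sep'[of d e] that \<delta> by force
  \<comment> \<open>The separation of differences applies to \<open>0\<close> as well, so \<open>U\<close> is uniformly discrete.\<close>
  have eqU: "x = y" if "x \<in> ?U" "y \<in> ?U" "dist x y < 2 * \<delta>" for x y
  proof -
    have "x - y = 0"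
    proof (rule sep)
      show "x - y \<in> difference_set ?U ?U" "0 \<in> difference_set ?U ?U"
        using that by (fastforce simp: difference_set_def)+
    qed (use that \<delta> R0 in \<open>auto simp: dist_norm\<close>)
    then show ?thesis by simp
  qed
  have iso: "E \<inter> ball u \<delta> = {u}" if "E \<subseteq> ?U" "u \<in> E" for E u
    using that eqU \<delta>(1) by (auto simp: subset_iff) (smt (verit) dist_commute)
  have det: "\<exists>c H. c > 0 \<and> bochner_almost_periodic H \<and>
     (\<forall>x. H x \<noteq> 0 \<longrightarrow> (\<exists>u\<in>E. dist u x < \<delta>)) \<and> (\<forall>u\<in>E. c \<le> norm (H u))"
    if "almost_periodically_detected E" "E \<subseteq> ?U" for E
    using that \<delta>(1) iso unfolding almost_periodically_detected_def by meson
  obtain c H where H: "c > 0" "bochner_almost_periodic H" "\<And>x. H x \<noteq> 0 \<Longrightarrow> \<exists>u\<in>A. dist u x < \<delta>"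
    "\<And>u. u \<in> A \<Longrightarrow> c \<le> norm (H u)" using det[OF assms(1)] by auto
  obtain c' H' where H': "c' > 0" "bochner_almost_periodic H'" "\<And>x. H' x \<noteq> 0 \<Longrightarrow> \<exists>u\<in>B. dist u x < \<delta>"
    "\<And>u. u \<in> B \<Longrightarrow> c' \<le> norm (H' u)" using det[OF assms(2)] by auto
  obtain \<C> where C: "finite \<C>" "\<Union>\<C> = UNIV"
    "\<forall>C\<in>\<C>. \<forall>x\<in>C. \<forall>y\<in>C. \<forall>z. norm (H (z + x) - H (z + y)) \<le> c / 2"
    "\<forall>C\<in>\<C>. \<forall>x\<in>C. \<forall>y\<in>C. \<forall>z. norm (H' (z + x) - H' (z + y)) \<le> c' / 2"
    by (rule bochner_almost_periodic_common_cover[OF H(2) H'(2) half_gt_zero half_gt_zero, OF H(1) H'(1)])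
  have moveA: "\<exists>v\<in>A. norm (v - u - (x - y)) < \<delta>" if "C \<in> \<C>" "x \<in> C" "y \<in> C" "u \<in> A" for C x y u
  proof -
    have "norm (H (u + (x - y)) - H u) \<le> c / 2" using C(3)[rule_format, OF that(1-3), of "u - y"] by (simp add: algebra_simps)
    with H(4)[OF that(4)] H(1) have "H (u + (x - y)) \<noteq> 0" by auto
    from H(3)[OF this] show ?thesis by (simp add: dist_norm diff_diff_eq)
  qed
  have moveB: "\<exists>v\<in>B. norm (v - u - (x - y)) < \<delta>" if "C \<in> \<C>" "x \<in> C" "y \<in> C" "u \<in> B" for C x y u
  proof -
    have "norm (H' (u + (x - y)) - H' u) \<le> c' / 2" using C(4)[rule_format, OF that(1-3), of "u - y"] by (simp add: algebra_simps)
    with H'(4)[OF that(4)] H'(1) have "H' (u + (x - y)) \<noteq> 0" by auto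
    from H'(3)[OF this] show ?thesis by (simp add: dist_norm diff_diff_eq)
  qed
  have shift: "\<exists>\<sigma>. norm (\<sigma> - (x - y)) < \<delta> \<and> (\<forall>u\<in>A. u + \<sigma> \<in> A) \<and> (\<forall>u\<in>B. u + \<sigma> \<in> B)"
    if "C \<in> \<C>" "x \<in> C" "y \<in> C" for C x y
  proof -
    have "\<exists>\<sigma>. norm (\<sigma> - (x - y)) < \<delta> \<and> (\<forall>u\<in>?U. \<forall>v\<in>?U. norm (v - u - (x - y)) < \<delta> \<longrightarrow> v = u + \<sigma>)"
      by (rule rigid_displacement[of ?U R, OF _ sep \<delta>(2)])
         (use R moveA[OF that] moveB[OF that] in \<open>blast+\<close>)
    with moveA[OF that] moveB[OF that] show ?thesis by (metis UnCI)
  qed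
  have period: "\<exists>\<sigma>\<in>?G. norm (\<sigma> - (x - y)) < \<delta>" if C: "C \<in> \<C>" "x \<in> C" "y \<in> C" for C x y
  proof -
    obtain \<sigma> where s: "norm (\<sigma> - (x - y)) < \<delta>" "\<And>u. u \<in> A \<Longrightarrow> u + \<sigma> \<in> A" "\<And>u. u \<in> B \<Longrightarrow> u + \<sigma> \<in> B"
      using shift[OF C] by blast
    obtain \<rho> where r: "norm (\<rho> - (y - x)) < \<delta>" "\<And>u. u \<in> A \<Longrightarrow> u + \<rho> \<in> A" "\<And>u. u \<in> B \<Longrightarrow> u + \<rho> \<in> B"
      using shift[OF C(1,3,2)] by blast
    have "norm (\<sigma> + \<rho>) < 2 * \<delta>"
      using s(1) r(1) norm_triangle_ineq[of "\<sigma> - (x - y)" "\<rho> - (y - x)"] by simp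
    obtain u where u: "u \<in> A" using R by blast
    have "u + \<sigma> + \<rho> = u"
    proof (rule eqU)
      show "u + \<sigma> + \<rho> \<in> ?U" "u \<in> ?U" using r(2)[OF s(2)[OF u]] u by simp_all
      show "dist (u + \<sigma> + \<rho>) u < 2 * \<delta>"
        using \<open>norm (\<sigma> + \<rho>) < 2 * \<delta>\<close> by (simp add: dist_norm add.assoc)
    qed
    then have "\<rho> = - \<sigma>" by (metis add.assoc add_cancel_left_right add_eq_0_iff)
    then have "(+) \<sigma> ` E = E" if "\<And>u. u \<in> E \<Longrightarrow> u + \<sigma> \<in> E" "\<And>u. u \<in> E \<Longrightarrow> u + \<rho> \<in> E" for E
    proof -
      have "u \<in> (+) \<sigma> ` E" if "u \<in> E" for u
        using \<open>\<And>u. u \<in> E \<Longrightarrow> u + \<rho> \<in> E\<close>[OF that] \<open>\<rho> = - \<sigma>\<close> by (intro image_eqI[of _ _ "u + \<rho>"]) auto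
      with that show ?thesis by (auto simp: add.commute)
    qed
    with s r show ?thesis by blast
  qed
  define k where "k C = (SOME x. x \<in> C)" for C :: "'a set"
  have "bounded (k ` \<C>)" using C(1) by (simp add: finite_imp_bounded)
  then obtain K where K: "\<And>C. C \<in> \<C> \<Longrightarrow> norm (k C) \<le> K" unfolding bounded_iff by auto
  have "\<exists>\<sigma>\<in>?G. dist \<sigma> x \<le> K + 1" for x
  proof -
    obtain C where C': "C \<in> \<C>" "x \<in> C" using C(2) by blast
    then have "k C \<in> C" unfolding k_def by (metis someI)
    then obtain \<sigma> where s: "\<sigma> \<in> ?G" "norm (\<sigma> - (x - k C)) < \<delta>" using period C' by blast
    have "norm (\<sigma> - x) \<le> norm (\<sigma> - (x - k C)) + norm (k C)"
      using norm_triangle_ineq4[of "\<sigma> - (x - k C)" "k C"] by simp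
    with s K[OF C'(1)] \<delta> have "dist \<sigma> x \<le> K + 1" by (simp add: dist_norm)
    with s show ?thesis by blast
  qed
  then show ?thesis unfolding relatively_dense_def by blast
qed

section \<open>Lattices of periods\<close>

text \<open>
  A vector \<open>a\<close> orthogonal to \<open>G\<close> would have arbitrarily long multiples, whose distance to \<open>G\<close> is at least
  their length.
\<close>

lemma relatively_dense_span:
  fixes G :: "'a::euclidean_space set"
  assumes "relatively_dense G"
  shows "span G = UNIV"
proof (rule ccontr)
  assume "span G \<noteq> UNIV"
  then obtain a where a: "a \<noteq> 0" "\<And>x. x \<in> span G \<Longrightarrow> a \<bullet> x = 0"
    using span_not_UNIV_orthogonal[of G] by auto
  obtain R where R: "\<And>x. \<exists>u\<in>G. dist u x \<le> R" using assms unfolding relatively_dense_def by blast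
  let ?x = "((\<bar>R\<bar> + 1) / norm a) *\<^sub>R a"
  obtain u where u: "u \<in> G" "dist u ?x \<le> R" using R by blast
  have "a \<bullet> u = 0" using a(2) u(1) span_base by blast
  then have "u \<bullet> ?x = 0" "?x \<bullet> u = 0" by (simp_all add: inner_commute)
  then have "(norm (u - ?x))\<^sup>2 = (norm u)\<^sup>2 + (norm ?x)\<^sup>2"
    unfolding power2_norm_eq_inner inner_diff_left inner_diff_right by linarith
  then have "(norm ?x)\<^sup>2 \<le> (norm (u - ?x))\<^sup>2" by simp
  then have "norm ?x \<le> norm (u - ?x)" by (simp add: power2_le_iff_abs_le)
  with u a(1) show False by (simp add: dist_norm)
qed

text \<open>
  Rounding down the coordinates with respect to \<open>T\<close> moves each point of \<open>E\<close> by the lattice into the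
  fundamental cell, which contains finitely many points of \<open>E\<close>.
\<close>

lemma finite_union_of_translates_if_periodic:
  fixes E :: "'a::euclidean_space set" and T :: "'a \<Rightarrow> 'a"
  assumes "linear T" "bij T" "discrete_in_space E"
    and per: "\<And>z u. z \<in> integer_points \<Longrightarrow> u \<in> E \<Longrightarrow> T z + u \<in> E"
  shows "finite_union_of_translates E (T ` integer_points)"
  unfolding finite_union_of_translates_def
proof (intro exI conjI)
  let ?F = "E \<inter> T ` cbox 0 One"
  have "bounded (T ` cbox 0 One)"
    by (intro compact_imp_bounded compact_continuous_image linear_continuous_on)
       (use assms(1) in \<open>auto simp: linear_conv_bounded_linear\<close>)
  then show "finite ?F" by (rule discrete_in_space_finite_bounded[OF assms(3)])
  show "E = (\<Union>t\<in>?F. (+) t ` T ` integer_points)"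
  proof (intro equalityI subsetI)
    fix u assume u: "u \<in> E"
    obtain x where x: "u = T x" using assms(2) by (metis bij_pointE)
    define z where "z = (\<Sum>b\<in>Basis. of_int \<lfloor>x \<bullet> b\<rfloor> *\<^sub>R b :: 'a)"
    have zb: "z \<bullet> b = of_int \<lfloor>x \<bullet> b\<rfloor>" if "b \<in> Basis" for b
      using that by (simp add: z_def)
    then have z: "z \<in> integer_points" "- z \<in> integer_points" by (auto simp: integer_points_def)
    have "x - z \<in> cbox 0 One"
      by (auto simp: mem_box inner_diff_left zb) linarith
    moreover have "T (x - z) \<in> E"
      using per[OF z(2) u] by (simp add: x linear_diff[OF assms(1)] linear_neg[OF assms(1)])
    ultimately have "T (x - z) \<in> ?F" by blast
    moreover have "u = T (x - z) + T z" by (simp add: x linear_diff[OF assms(1)])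
    ultimately show "u \<in> (\<Union>t\<in>?F. (+) t ` T ` integer_points)" using z(1) by blast
  next
    fix u assume "u \<in> (\<Union>t\<in>?F. (+) t ` T ` integer_points)"
    then show "u \<in> E" using per by (auto simp: add.commute)
  qed
qed

lemma lattice_inside_relatively_dense_group:
  fixes G :: "'a::euclidean_space set"
  assumes "relatively_dense G" "0 \<in> G" "\<And>x y. x \<in> G \<Longrightarrow> y \<in> G \<Longrightarrow> x + y \<in> G" "\<And>x. x \<in> G \<Longrightarrow> - x \<in> G"
  obtains T :: "'a \<Rightarrow> 'a" where "linear T" "bij T" "T ` integer_points \<subseteq> G"
proof -
  obtain B where B: "B \<subseteq> G" "independent B" "G \<subseteq> span B" "card B = dim G"
    using basis_exists[of G] by auto
  have sB: "span B = UNIV"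
    using span_mono[OF B(3)] relatively_dense_span[OF assms(1)] by (auto simp: span_span)
  have "dim G = dim (span G)" by simp
  then have "card B = DIM('a)" using B(4) relatively_dense_span[OF assms(1)] by simp
  moreover have "finite B" using B(2) by (rule independent_imp_finite)
  ultimately obtain f where f: "bij_betw f (Basis::'a set) B"
    using finite_same_card_bij[OF finite_Basis \<open>finite B\<close>] by auto
  define T where "T x = (\<Sum>b\<in>Basis. (x \<bullet> b) *\<^sub>R f b)" for x
  have lin: "linear T"
    by (rule linearI) (simp_all add: T_def inner_add_left scaleR_left_distrib sum.distrib scaleR_sum_right)
  have Tb: "T b = f b" if "b \<in> Basis" for b
    using that by (simp add: T_def inner_Basis if_distrib[of "\<lambda>c. c *\<^sub>R _"] cong: if_cong)
  have "B \<subseteq> range T"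
  proof
    fix y assume "y \<in> B"
    then obtain b where "b \<in> Basis" "y = f b" using bij_betw_imp_surj_on[OF f] by auto
    then show "y \<in> range T" using Tb[of b] by (intro range_eqI[of _ _ b]) simp
  qed
  then have "span B \<subseteq> range T" by (rule span_minimal[OF _ linear_subspace_image[OF lin subspace_UNIV]])
  then have "surj T" using sB by auto
  then have bij: "bij T" using linear_surjective_imp_injective[OF lin] by (simp add: bij_def)
  have multnat: "of_nat n *\<^sub>R x \<in> G" if "x \<in> G" for x n
    by (induction n) (use assms that in \<open>auto simp: scaleR_left_distrib\<close>)
  have mult: "of_int n *\<^sub>R x \<in> G" if "x \<in> G" for x n
  proof (cases "n \<ge> 0")
    case True
    then show ?thesis using multnat[OF that, of "nat n"] by simp
  next
    case False
    then show ?thesis using assms(4)[OF multnat[OF that, of "nat (- n)"]] by simp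
  qed
  have sum: "(\<Sum>b\<in>S. g b) \<in> G" if "\<And>b. b \<in> S \<Longrightarrow> g b \<in> G" for S :: "'a set" and g
    using that assms(2,3) by (induction S rule: infinite_finite_induct) auto
  have "T z \<in> G" if "z \<in> integer_points" for z
    unfolding T_def
  proof (rule sum)
    fix b :: 'a assume b: "b \<in> Basis"
    then have "z \<bullet> b \<in> \<int>" using that by (simp add: integer_points_def)
    then obtain n where "z \<bullet> b = of_int n" by (elim Ints_cases)
    moreover have "f b \<in> G" using f b B(1) bij_betwE by blast
    ultimately show "(z \<bullet> b) *\<^sub>R f b \<in> G" using mult by simp
  qed
  then show thesis using that lin bij by blast
qed

text \<open>
  Relative density of either set makes the difference set of the union discrete, starting from the
  single hypothesis on \<open>A - B\<close>. The lattice is then found inside the common periods.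
\<close>

lemma almost_periodic_sets_with_discrete_differences:
  fixes A B :: "'a::euclidean_space set"
  assumes "almost_periodically_detected A" "almost_periodically_detected B" "A \<noteq> {}" "B \<noteq> {}"
    and disc: "discrete_in_space (difference_set A B)"
  shows "\<exists>L. full_rank_lattice L \<and> finite_union_of_translates A L \<and> finite_union_of_translates B L"
proof -
  have translate: "discrete_in_space A" if "discrete_in_space (difference_set A B)" "b \<in> B" for A B and b :: 'a
    unfolding discrete_in_space_def
  proof
    fix x :: 'a
    have "A \<inter> ball x 1 \<subseteq> (+) b ` (difference_set A B \<inter> ball (x - b) 1)"
    proof
      fix a assume "a \<in> A \<inter> ball x 1"
      then have "a - b \<in> difference_set A B \<inter> ball (x - b) 1"
        using that(2) by (auto simp: difference_set_def dist_norm)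
      then show "a \<in> (+) b ` (difference_set A B \<inter> ball (x - b) 1)" by (rule rev_image_eqI) simp
    qed
    then show "finite (A \<inter> ball x 1)"
      using that(1) finite_subset unfolding discrete_in_space_def by blast
  qed
  have disc': "discrete_in_space (difference_set B A)"
    unfolding discrete_in_space_def
  proof
    fix x :: 'a
    have "difference_set B A \<inter> ball x 1 \<subseteq> uminus ` (difference_set A B \<inter> ball (- x) 1)"
    proof
      fix d assume d: "d \<in> difference_set B A \<inter> ball x 1"
      then have "- d \<in> difference_set A B"
        by (auto simp: difference_set_def) (metis minus_diff_eq)
      moreover have "dist (- x) (- d) < 1" using d by (simp add: dist_minus)
      ultimately show "d \<in> uminus ` (difference_set A B \<inter> ball (- x) 1)"
        by (intro image_eqI[of _ _ "- d"]) auto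
    qed
    then show "finite (difference_set B A \<inter> ball x 1)"
      using disc finite_subset unfolding discrete_in_space_def by blast
  qed
  have dA: "discrete_in_space A" and dB: "discrete_in_space B"
    using translate disc disc' assms(3,4) by blast+
  have rA: "relatively_dense A" and rB: "relatively_dense B"
    using detected_relatively_dense assms dA dB by blast+
  have "discrete_in_space (difference_set B B)"
    using discrete_differences_via_relatively_dense[OF disc' disc' rA] .
  moreover have "difference_set (A \<union> B) B = difference_set A B \<union> difference_set B B"
    by (auto simp: difference_set_def)
  ultimately have "discrete_in_space (difference_set (A \<union> B) B)"
    using disc unfolding discrete_in_space_def by (simp add: Int_Un_distrib2)
  from discrete_differences_via_relatively_dense[OF this this rB]
  have dU: "discrete_in_space (difference_set (A \<union> B) (A \<union> B))" .
  let ?G = "{\<sigma>. (+) \<sigma> ` A = A \<and> (+) \<sigma> ` B = B}"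
  have G: "relatively_dense ?G" by (rule common_exact_periods[OF assms(1,2) rA dU])
  have plus: "(+) (\<sigma> + \<rho>) ` E = (+) \<sigma> ` (+) \<rho> ` E" for \<sigma> \<rho> :: 'a and E
    by (simp add: image_image add.assoc)
  have minus: "(+) (- \<sigma>) ` E = E" if "(+) \<sigma> ` E = E" for \<sigma> :: 'a and E
    using plus[of "- \<sigma>" \<sigma> E] that by simp
  have G0: "0 \<in> ?G" by simp
  have Gadd: "x + y \<in> ?G" if "x \<in> ?G" "y \<in> ?G" for x y
    using that by (simp only: mem_Collect_eq plus)
  have Gneg: "- x \<in> ?G" if "x \<in> ?G" for x
    using that minus by (simp only: mem_Collect_eq)
  obtain T :: "'a \<Rightarrow> 'a" where T: "linear T" "bij T" "T ` integer_points \<subseteq> ?G"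
    using lattice_inside_relatively_dense_group[OF G G0 Gadd Gneg] .
  have "finite_union_of_translates A (T ` integer_points)" "finite_union_of_translates B (T ` integer_points)"
    by (rule finite_union_of_translates_if_periodic[OF T(1,2)], use dA dB T(3) in blast, use T(3) in blast)+
  moreover have "full_rank_lattice (T ` integer_points)"
    using T unfolding full_rank_lattice_def by blast
  ultimately show ?thesis by blast
qed

section \<open>Large Fourier quasicrystals with discrete differences\<close>

text \<open>
  The detecting function is \<open>\<mu>\<close> convolved with a bump. Its exponent \<open>n\<close> is chosen so large that the decay
  of its Fourier transform beats the growth of the masses of the transform of \<open>\<mu>\<close>; its parameter \<open>\<kappa>\<close>
  controls the size of the support, so only \<open>\<kappa>\<close> has to vary with \<open>\<delta>\<close>.
\<close>

lemma large_fourier_quasicrystal_detected: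
  fixes \<mu> :: "'a::euclidean_space distribution"
  assumes "large_fourier_quasicrystal \<mu> \<Lambda>"
  shows "almost_periodically_detected \<Lambda>"
proof -
  obtain a \<Gamma> b where \<mu>: "slowly_increasing_atomic \<mu> \<Lambda> a"
    and \<mu>_hat: "slowly_increasing_atomic (fourier_distribution \<mu>) \<Gamma> b"
    and inf: "0 < (INF z\<in>\<Lambda>. ereal (norm (a z)))"
    using assms unfolding large_fourier_quasicrystal_def fourier_quasicrystal_def by blast
  obtain c where c: "0 < ereal c" "ereal c < (INF z\<in>\<Lambda>. ereal (norm (a z)))"
    using ereal_dense2[OF inf] by auto
  have a: "c \<le> norm (a z)" if "z \<in> \<Lambda>" for z
  proof -
    have "ereal c \<le> ereal (norm (a z))" using c(2) INF_lower[OF that] by (rule less_imp_le[OF less_le_trans])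
    then show ?thesis by simp
  qed
  obtain N where N: "(\<lambda>r::real. \<Sum>\<^sub>\<infinity>z\<in>\<Gamma> \<inter> ball 0 r. norm (b z)) \<in> O[at_top](\<lambda>r. r ^ N)"
    and balls: "\<And>r. (\<lambda>z. norm (b z)) summable_on (\<Gamma> \<inter> ball 0 r)"
    using \<mu>_hat unfolding slowly_increasing_atomic_def by blast
  define n where "n = 2 * (N + 1) + 1"
  have n: "n > 0" by (simp add: n_def)
  show ?thesis
    unfolding almost_periodically_detected_def
  proof (intro exI[of _ c] conjI allI impI)
    show "0 < c" using c(1) by simp
    fix \<delta> :: real assume \<delta>: "\<delta> > 0"
    \<comment> \<open>This makes the bound on the support equal to \<open>\<delta> / 2\<close>.\<close>
    define \<kappa> where "\<kappa> = real DIM('a) * pi / \<delta>"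
    have \<kappa>: "\<kappa> > 0" using \<delta> by (simp add: \<kappa>_def)
    have supp: "norm x < \<delta>" if "cube_bump n \<kappa> x \<noteq> 0" for x :: 'a
      using cube_bump_support[OF n \<kappa> that] \<delta> by (simp add: \<kappa>_def)
    obtain C where C: "C \<ge> 0" "\<And>w::'a. (1 + (norm w)\<^sup>2) ^ (N + 1) * norm (cube_bump_fourier n \<kappa> w) \<le> C"
      using cube_bump_fourier_decay[OF \<kappa>, of "N + 1" n] by (auto simp: n_def)
    have sum: "(\<lambda>\<gamma>. norm (b \<gamma> * cube_bump_fourier n \<kappa> ((2 * pi) *\<^sub>R \<gamma>))) summable_on \<Gamma>"
    proof (rule summable_on_comparison_test)
      show "(\<lambda>\<gamma>. C * (norm (b \<gamma>) / (1 + (norm \<gamma>)\<^sup>2) ^ (N + 1))) summable_on \<Gamma>"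
        by (rule summable_on_cmult_right[OF summable_on_polynomial_decay[OF balls N]])
      fix \<gamma> :: 'a
      let ?w = "(2 * pi) *\<^sub>R \<gamma>"
      have "1 * norm \<gamma> \<le> (2 * pi) * norm \<gamma>" using pi_gt3 by (intro mult_right_mono) auto
      then have "norm \<gamma> \<le> norm ?w" by simp
      then have "(1 + (norm \<gamma>)\<^sup>2) ^ (N + 1) \<le> (1 + (norm ?w)\<^sup>2) ^ (N + 1)"
        by (intro power_mono add_mono order_refl) auto
      then have "(1 + (norm \<gamma>)\<^sup>2) ^ (N + 1) * norm (cube_bump_fourier n \<kappa> ?w) \<le> C"
        by (intro order_trans[OF mult_right_mono C(2)]) auto
      moreover have "(1 + (norm \<gamma>)\<^sup>2) ^ (N + 1) > 0" by (intro zero_less_power add_pos_nonneg) auto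
      ultimately have "norm (cube_bump_fourier n \<kappa> ?w) \<le> C / (1 + (norm \<gamma>)\<^sup>2) ^ (N + 1)"
        by (simp only: pos_le_divide_eq mult.commute)
      from mult_left_mono[OF this norm_ge_zero[of "b \<gamma>"]]
      show "norm (b \<gamma> * cube_bump_fourier n \<kappa> ?w) \<le> C * (norm (b \<gamma>) / (1 + (norm \<gamma>)\<^sup>2) ^ (N + 1))"
        by (simp add: norm_mult mult.commute)
    qed auto
    define H where "H x = (\<Sum>\<^sub>\<infinity>z\<in>\<Lambda>. a z * of_real (cube_bump n \<kappa> (z - x)))" for x
    have "bochner_almost_periodic H"
      by (rule bochner_almost_periodic_exponential_series[OF sum])
         (unfold H_def, rule cube_bump_Poisson_summation[OF \<mu> \<mu>_hat n \<kappa> sum])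
    moreover have "\<exists>u\<in>\<Lambda>. dist u x < \<delta>" if "H x \<noteq> 0" for x
    proof (rule ccontr)
      assume "\<not> (\<exists>u\<in>\<Lambda>. dist u x < \<delta>)"
      then have "cube_bump n \<kappa> (u - x) = 0" if "u \<in> \<Lambda>" for u
        using supp[of "u - x"] that by (auto simp: dist_norm)
      then have "H x = 0" unfolding H_def by (intro infsum_0) simp
      with that show False by simp
    qed
    moreover have "c \<le> norm (H u)" if u: "u \<in> \<Lambda>" "\<Lambda> \<inter> ball u \<delta> = {u}" for u
    proof -
      have "H u = (\<Sum>\<^sub>\<infinity>z\<in>{u}. a z * of_real (cube_bump n \<kappa> (z - u)))"
        unfolding H_def
      proof (rule infsum_cong_neutral)
        fix z assume z: "z \<in> \<Lambda> - {u}"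
        then have "z \<notin> ball u \<delta>" using u(2) by blast
        then have "cube_bump n \<kappa> (z - u) = 0"
          using supp[of "z - u"] by (auto simp: dist_norm norm_minus_commute)
        then show "a z * of_real (cube_bump n \<kappa> (z - u)) = 0" by simp
      next
        fix z assume "z \<in> {u} - \<Lambda>"
        with u(1) show "a z * of_real (cube_bump n \<kappa> (z - u)) = 0" by blast
      qed simp
      then show ?thesis using a[OF u(1)] by simp
    qed
    ultimately show "\<exists>H. bochner_almost_periodic H \<and> (\<forall>x. H x \<noteq> 0 \<longrightarrow> (\<exists>u\<in>\<Lambda>. dist u x < \<delta>))
        \<and> (\<forall>u\<in>\<Lambda>. \<Lambda> \<inter> ball u \<delta> = {u} \<longrightarrow> c \<le> norm (H u))" by blast
  qed
qed

lemma nonzero_quasicrystal_support_nonempty: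
  assumes "large_fourier_quasicrystal \<mu> \<Lambda>" "nonzero_distribution \<mu>"
  shows "\<Lambda> \<noteq> {}"
proof
  assume "\<Lambda> = {}"
  then obtain a where "\<And>f. f \<in> schwartz \<Longrightarrow> ((\<lambda>z. a z * dirac z f) has_sum \<mu> f) {}"
    using assms(1)
    unfolding large_fourier_quasicrystal_def fourier_quasicrystal_def slowly_increasing_atomic_def by blast
  then have "\<mu> f = 0" if "f \<in> schwartz" for f
    using infsumI[of _ "{}" "\<mu> f"] that by fastforce
  with assms(2) show False unfolding nonzero_distribution_def by blast
qed

theorem theorem13:
  fixes \<mu>\<^sub>1 \<mu>\<^sub>2 :: "'a::euclidean_space distribution" and \<Lambda>\<^sub>1 \<Lambda>\<^sub>2 :: "'a set"
  assumes "large_fourier_quasicrystal \<mu>\<^sub>1 \<Lambda>\<^sub>1" and "nonzero_distribution \<mu>\<^sub>1"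
    and "large_fourier_quasicrystal \<mu>\<^sub>2 \<Lambda>\<^sub>2" and "nonzero_distribution \<mu>\<^sub>2"
    and "discrete_in_space {x - y | x y. x \<in> \<Lambda>\<^sub>1 \<and> y \<in> \<Lambda>\<^sub>2}"
  shows "\<exists>L. full_rank_lattice L \<and>
             finite_union_of_translates \<Lambda>\<^sub>1 L \<and> finite_union_of_translates \<Lambda>\<^sub>2 L"
proof (rule almost_periodic_sets_with_discrete_differences)
  show "almost_periodically_detected \<Lambda>\<^sub>1" "almost_periodically_detected \<Lambda>\<^sub>2"
    by (rule large_fourier_quasicrystal_detected[OF assms(1)], rule large_fourier_quasicrystal_detected[OF assms(3)])
  show "\<Lambda>\<^sub>1 \<noteq> {}" "\<Lambda>\<^sub>2 \<noteq> {}"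
    using assms(1-4) nonzero_quasicrystal_support_nonempty by blast+
  show "discrete_in_space (difference_set \<Lambda>\<^sub>1 \<Lambda>\<^sub>2)"
    using assms(5) by (simp add: difference_set_def)
qed

end
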